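(* Let $\mathcal P$ be a convex, pre-Hahn-localizable family of probability measures on a measurable space $(\Omega,\mathcal F)$ with a localization $\mathcal Q$ whose supports $\{S_Q\}_{Q\in\mathcal Q}$ are pairwise disjoint, and let $\mathcal H=\mathcal H_{\mathcal F}^{\mathcal Q}$ be the Hahn-extension. Then the restriction map $\mathrm{ca}(\mathcal H,\mathcal P^{\mathcal Q})\to\mathrm{ca}(\mathcal F,\mathcal P)$, $\nu\mapsto\nu|_{\mathcal F}$, is an isometric isomorphism, and $\mathrm{ca}(\mathcal F,\mathcal P)'$ is isometrically isomorphic to $\mathbb L^\infty(\mathcal H,\mathcal P^{\mathcal Q})$.
   Context: For a σ-algebra $\mathcal G$ and family $\mathcal R$ of probability measures on it: a set is $\mathcal R$-polar if contained in some $N\in\mathcal G$ with $R(N)=0$ for all $R\in\mathcal R$; $\mathcal R$-q.s. means outside such a set; $\mathbb L^\infty(\mathcal G,\mathcal R)$ is the space of $\mathcal G$-measurable functions bounded $\mathcal R$-q.s. modulo $\mathcal R$-q.s. equality, with norm $\inf\{M>0:|f|\le M\ \mathcal R\text{-q.s.}\}$; $\mathrm{ca}(\mathcal G,\mathcal R)$ is the set of finite signed measures $\mu$ on $\mathcal G$ with $|\mu|\ll R$ for some $R\in\mathcal R$, with total variation norm. $\mathcal P\lll\mathcal Q$ means each $P\in\mathcal P$ is absolutely continuous w.r.t. some $Q\in\mathcal Q$; $\mathrm{sconv}(\mathcal Q)$ is the set of countable convex combinations of elements of $\mathcal Q$. $\mathcal P$ is pre-Hahn-localizable with localization $\mathcal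 Q$ (a family of probability measures on $\mathcal F$) and supports $S_Q\in\mathcal F$ if $Q(S_R)=\delta_{QR}$ for $Q,R\in\mathcal Q$ and $\mathcal Q\lll\mathcal P\lll\mathrm{sconv}(\mathcal Q)$. The Hahn-extension is $\mathcal H_{\mathcal F}^{\mathcal Q}=\sigma\big(\mathcal F\cup\{\bigcup_{Q\in\mathcal Q}E_Q: E_Q\in\mathcal F, E_Q\subseteq S_Q\}\big)$. For $\mu\in\mathrm{ca}(\mathcal F,\mathcal P)$ let $\mathcal Q(\mu)=\{Q\in\mathcal Q:|\mu|(S_Q)>0\}$ (a countable set) and define $\mu^{\mathcal Q}(A)=\sum_{Q\in\mathcal Q(\mu)}\mu(A\cap S_Q)$ for $A\in\mathcal H_{\mathcal F}^{\mathcal Q}$; this is a finite signed measure on $\mathcal H_{\mathcal F}^{\mathcal Q}$ extending $\mu$. $\mathcal P^{\mathcal Q}=\{P^{\mathcal Q}:P\in\mathcal P\}$. *)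

theory Defs
  imports "HOL-Analysis.Analysis"
begin

text \<open>Conventions. A (finite signed) measure on a sigma-algebra G over Omega is represented
by a function 'a set => real which is countably additive on G and (canonically) 0 outside G.
Families of (probability) measures are sets of such functions.\<close>

type_synonym 'a sm = "'a set \<Rightarrow> real"

definition is_sm :: "'a set \<Rightarrow> 'a set set \<Rightarrow> 'a sm \<Rightarrow> bool" where
  "is_sm \<Omega> G \<mu> \<longleftrightarrow> (\<forall>A. A \<notin> G \<longrightarrow> \<mu> A = 0) \<and>
     (\<forall>A :: nat \<Rightarrow> 'a set. range A \<subseteq> G \<longrightarrow> disjoint_family A \<longrightarrow>
        (\<lambda>i. \<mu> (A i)) sums \<mu> (\<Union>i. A i))"

definition is_prob :: "'a set \<Rightarrow> 'a set set \<Rightarrow> 'a sm \<Rightarrow> bool" where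
  "is_prob \<Omega> G P \<longleftrightarrow> is_sm \<Omega> G P \<and> (\<forall>A\<in>G. 0 \<le> P A) \<and> P \<Omega> = 1"

definition tv :: "'a set set \<Rightarrow> 'a sm \<Rightarrow> 'a set \<Rightarrow> real" where
  "tv G \<mu> A = Sup {(\<Sum>B\<in>D. \<bar>\<mu> B\<bar>) | D. finite D \<and> D \<subseteq> G \<and> disjoint D \<and> \<Union>D \<subseteq> A}"

definition tvnorm :: "'a set \<Rightarrow> 'a set set \<Rightarrow> 'a sm \<Rightarrow> real" where
  "tvnorm \<Omega> G \<mu> = tv G \<mu> \<Omega>"

definition abs_cont :: "'a set set \<Rightarrow> 'a sm \<Rightarrow> 'a sm \<Rightarrow> bool" where
  "abs_cont G \<mu> R \<longleftrightarrow> (\<forall>A\<in>G. R A = 0 \<longrightarrow> tv G \<mu> A = 0)"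

definition ca :: "'a set \<Rightarrow> 'a set set \<Rightarrow> 'a sm set \<Rightarrow> 'a sm set" where
  "ca \<Omega> G \<R> = {\<mu>. is_sm \<Omega> G \<mu> \<and> (\<exists>R\<in>\<R>. abs_cont G \<mu> R)}"

definition polar :: "'a set set \<Rightarrow> 'a sm set \<Rightarrow> 'a set \<Rightarrow> bool" where
  "polar G \<R> X \<longleftrightarrow> (\<exists>N\<in>G. X \<subseteq> N \<and> (\<forall>R\<in>\<R>. R N = 0))"

definition qs :: "'a set \<Rightarrow> 'a set set \<Rightarrow> 'a sm set \<Rightarrow> ('a \<Rightarrow> bool) \<Rightarrow> bool" where
  "qs \<Omega> G \<R> p \<longleftrightarrow> polar G \<R> {\<omega>\<in>\<Omega>. \<not> p \<omega>}"

definition meas_space :: "'a set \<Rightarrow> 'a set set \<Rightarrow> 'a measure" where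
  "meas_space \<Omega> G = measure_of \<Omega> G (\<lambda>_. 0)"

text \<open>Representatives of L-infinity(G,R): G-measurable functions bounded R-q.s.\<close>
definition Linf :: "'a set \<Rightarrow> 'a set set \<Rightarrow> 'a sm set \<Rightarrow> ('a \<Rightarrow> real) set" where
  "Linf \<Omega> G \<R> = {f. f \<in> borel_measurable (meas_space \<Omega> G) \<and> (\<exists>M. qs \<Omega> G \<R> (\<lambda>\<omega>. \<bar>f \<omega>\<bar> \<le> M))}"

definition linf_norm :: "'a set \<Rightarrow> 'a set set \<Rightarrow> 'a sm set \<Rightarrow> ('a \<Rightarrow> real) \<Rightarrow> real" where
  "linf_norm \<Omega> G \<R> f = Inf {M. 0 < M \<and> qs \<Omega> G \<R> (\<lambda>\<omega>. \<bar>f \<omega>\<bar> \<le> M)}"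

definition blf :: "'a set \<Rightarrow> 'a set set \<Rightarrow> 'a sm set \<Rightarrow> ('a sm \<Rightarrow> real) \<Rightarrow> bool" where
  "blf \<Omega> G \<R> \<phi> \<longleftrightarrow>
     (\<forall>\<mu>\<in>ca \<Omega> G \<R>. \<forall>\<nu>\<in>ca \<Omega> G \<R>. \<forall>a b.
        \<phi> (\<lambda>A. a * \<mu> A + b * \<nu> A) = a * \<phi> \<mu> + b * \<phi> \<nu>) \<and>
     (\<exists>C. \<forall>\<mu>\<in>ca \<Omega> G \<R>. \<bar>\<phi> \<mu>\<bar> \<le> C * tvnorm \<Omega> G \<mu>)"

definition opnorm :: "'a set \<Rightarrow> 'a set set \<Rightarrow> 'a sm set \<Rightarrow> ('a sm \<Rightarrow> real) \<Rightarrow> real" where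
  "opnorm \<Omega> G \<R> \<phi> = Inf {C. 0 \<le> C \<and> (\<forall>\<mu>\<in>ca \<Omega> G \<R>. \<bar>\<phi> \<mu>\<bar> \<le> C * tvnorm \<Omega> G \<mu>)}"

definition lll :: "'a set set \<Rightarrow> 'a sm set \<Rightarrow> 'a sm set \<Rightarrow> bool" where
  "lll G \<P> \<Q> \<longleftrightarrow> (\<forall>P\<in>\<P>. \<exists>Q\<in>\<Q>. abs_cont G P Q)"

definition sconv :: "'a sm set \<Rightarrow> 'a sm set" where
  "sconv \<Q> = {\<mu>. \<exists>(c :: nat \<Rightarrow> real) q. (\<forall>n. 0 \<le> c n) \<and> c sums 1 \<and> (\<forall>n. q n \<in> \<Q>) \<and>
                  (\<forall>A. (\<lambda>n. c n * q n A) sums \<mu> A)}"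

definition convex_family :: "'a sm set \<Rightarrow> bool" where
  "convex_family \<P> \<longleftrightarrow> (\<forall>P\<in>\<P>. \<forall>P'\<in>\<P>. \<forall>t::real. 0 \<le> t \<and> t \<le> 1 \<longrightarrow>
       (\<lambda>A. t * P A + (1 - t) * P' A) \<in> \<P>)"

definition pre_hahn :: "'a set \<Rightarrow> 'a set set \<Rightarrow> 'a sm set \<Rightarrow> 'a sm set \<Rightarrow> ('a sm \<Rightarrow> 'a set) \<Rightarrow> bool" where
  "pre_hahn \<Omega> F \<P> \<Q> S \<longleftrightarrow> (\<forall>Q\<in>\<Q>. is_prob \<Omega> F Q) \<and> (\<forall>Q\<in>\<Q>. S Q \<in> F) \<and>
     (\<forall>Q\<in>\<Q>. \<forall>R\<in>\<Q>. Q (S R) = (if Q = R then 1 else 0)) \<and>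
     lll F \<Q> \<P> \<and> lll F \<P> (sconv \<Q>)"

definition hahn_ext :: "'a set \<Rightarrow> 'a set set \<Rightarrow> 'a sm set \<Rightarrow> ('a sm \<Rightarrow> 'a set) \<Rightarrow> 'a set set" where
  "hahn_ext \<Omega> F \<Q> S = sigma_sets \<Omega>
     (F \<union> {(\<Union>Q\<in>\<Q>. E Q) | E. \<forall>Q\<in>\<Q>. E Q \<in> F \<and> E Q \<subseteq> S Q})"

definition ext :: "'a set \<Rightarrow> 'a set set \<Rightarrow> 'a sm set \<Rightarrow> ('a sm \<Rightarrow> 'a set) \<Rightarrow> 'a sm \<Rightarrow> 'a sm" where
  "ext \<Omega> F \<Q> S \<mu> A = (if A \<in> hahn_ext \<Omega> F \<Q> S
      then (\<Sum>\<^sub>\<infinity>Q\<in>{Q\<in>\<Q>. 0 < tv F \<mu> (S Q)}. \<mu> (A \<inter> S Q)) else 0)"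

definition restr :: "'a set set \<Rightarrow> 'a sm \<Rightarrow> 'a sm" where
  "restr F \<nu> = (\<lambda>A. if A \<in> F then \<nu> A else 0)"

end

(* The integral of f against a signed measure nu is defined through the Jordan decomposition of nu;
   when nu has density h with respect to R it is the R-integral of f h, so on each family
   dominated by R the pairing is that of L-infinity with L1. Convexity supplies a common dominating
   R for any two measures.

   Each measure in ca(F, P) is carried by countably many of the supports S_Q. A set of H meets
   a countable union of supports in a set of F, so the extension of mu is
   A |-> mu (A Int U) for a single such union U, and total variations agree.

   A bounded functional phi on ca(H, P^Q), restricted to measures dominated by a single Q, is given by
   a bounded density f_Q. The Hahn-extension makes the function equal to f_Q on each S_Q measurable.
   It represents phi because A |-> phi (nu restricted to A) is countably additive, so the
   difference of the two functionals vanishes as soon as it vanishes on every S_Q. *)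
theory Submission
  imports Defs
begin

section \<open>Total variation of a signed measure\<close>

text \<open>In general no single measure dominates all of ca(H, P^Q), so the duality of L1 and
  L-infinity is available only locally, and there may be uncountably many local densities f_Q. Each
  is determined only up to a Q-null set, and an uncountable union of null sets need not be polar.
  Two choices avoid the loss: every f_Q is truncated at one constant that bounds the functional, so
  the glued function is bounded at every point; and equality of functionals is checked for one
  measure at a time, which sees only countably many supports. Conversely, a quasi-sure bound asks
  for one exceptional set serving all measures; for a measurable function the set where the bound
  fails is such a set.

  Of the two halves of a localization, domination of P by countable mixtures of Q gives the
  countable carriers, while domination of Q by P makes every Q a measure that can be extended and
  fed to a functional.

  A signed measure is here only a countably additive real function. That its total variation is
  finite has to be derived, and until then the supremum defining it is meaningless.\<close>

lemma sm_sums: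
  "is_sm \<Omega> G \<mu> \<Longrightarrow> range A \<subseteq> G \<Longrightarrow> disjoint_family A \<Longrightarrow> (\<lambda>i::nat. \<mu> (A i)) sums \<mu> (\<Union>i. A i)"
  unfolding is_sm_def by simp

lemma sm_outside: "is_sm \<Omega> G \<mu> \<Longrightarrow> A \<notin> G \<Longrightarrow> \<mu> A = 0"
  unfolding is_sm_def by simp

lemma is_smI:
  assumes "\<And>A. A \<notin> G \<Longrightarrow> \<mu> A = 0"
    and "\<And>A::nat \<Rightarrow> 'a set. range A \<subseteq> G \<Longrightarrow> disjoint_family A \<Longrightarrow> (\<lambda>i. \<mu> (A i)) sums \<mu> (\<Union>i. A i)"
  shows "is_sm (\<Omega> :: 'a set) G \<mu>"
  using assms unfolding is_sm_def by simp

lemma sm_lincomb: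
  assumes "is_sm \<Omega> G \<mu>" "is_sm \<Omega> G \<nu>"
  shows "is_sm \<Omega> G (\<lambda>A. a * \<mu> A + b * \<nu> A)"
  by (rule is_smI) (simp_all add: sm_outside[OF assms(1)] sm_outside[OF assms(2)] sums_add sums_mult
      sm_sums[OF assms(1)] sm_sums[OF assms(2)])

section \<open>Finite additivity of signed measures\<close>

context sigma_algebra
begin

lemma sm_empty: "\<mu> {} = 0" if "is_sm \<Omega> M \<mu>"
proof -
  have "disjoint_family (\<lambda>_::nat. {}::'a set)" "range (\<lambda>_::nat. {}::'a set) \<subseteq> M"
    by (auto simp: disjoint_family_on_def)
  then have "(\<lambda>_::nat. \<mu> {}) sums \<mu> (\<Union>i::nat. {})"
    using sm_sums[OF that] by blast
  then have "summable (\<lambda>_::nat. \<mu> {})" by (rule sums_summable)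
  then show ?thesis by (simp add: summable_const_iff)
qed

lemma sm_Un: "\<mu> (A \<union> B) = \<mu> A + \<mu> B"
  if sm: "is_sm \<Omega> M \<mu>" and "A \<in> M" "B \<in> M" "A \<inter> B = {}"
proof -
  have "disjoint_family (binaryset A B)" "range (binaryset A B) \<subseteq> M"
    using that by (auto simp: disjoint_family_on_def binaryset_def)
  then have "(\<lambda>i. \<mu> (binaryset A B i)) sums \<mu> (A \<union> B)"
    using sm_sums[OF sm, of "binaryset A B"] by (simp add: UN_binaryset_eq)
  then show ?thesis
    using binaryset_sums[of \<mu> A B, OF sm_empty[OF sm]] by (rule sums_unique2)
qed

lemma sm_Diff: "\<mu> (A - B) = \<mu> A - \<mu> B"
  if "is_sm \<Omega> M \<mu>" "A \<in> M" "B \<in> M" "B \<subseteq> A"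
proof -
  have "\<mu> (B \<union> (A - B)) = \<mu> B + \<mu> (A - B)"
    using that by (intro sm_Un) auto
  then show ?thesis using that by (simp add: Un_absorb1)
qed

lemma sm_Union: "\<mu> (\<Union>D) = (\<Sum>B\<in>D. \<mu> B)"
  if sm: "is_sm \<Omega> M \<mu>" and "finite D" "D \<subseteq> M" "disjoint D"
  using that(2-)
proof (induction D)
  case empty
  then show ?case by (simp add: sm_empty[OF sm])
next
  case (insert B D)
  have "B \<inter> \<Union>D = {}"
    using insert by (auto simp: disjoint_def)
  moreover have "\<Union>D \<in> M" using insert by auto
  ultimately have "\<mu> (B \<union> \<Union>D) = \<mu> B + \<mu> (\<Union>D)"
    using insert by (intro sm_Un[OF sm]) auto
  then show ?case using insert by (auto simp: disjoint_def)
qed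

end

text \<open>The set under the supremum in \<open>tv\<close> has its own name because its boundedness
  must be proved first: \<open>Sup\<close> of an unbounded set of reals carries no information. The
  families need not cover A, which makes monotonicity in A immediate.\<close>

definition varsums :: "'a set set \<Rightarrow> 'a sm \<Rightarrow> 'a set \<Rightarrow> real set" where
  "varsums G \<mu> A = {(\<Sum>B\<in>D. \<bar>\<mu> B\<bar>) | D. finite D \<and> D \<subseteq> G \<and> disjoint D \<and> \<Union>D \<subseteq> A}"

lemma tv_eq_Sup: "tv G \<mu> A = Sup (varsums G \<mu> A)"
  by (simp add: tv_def varsums_def)

lemma varsumsI:
  "finite D \<Longrightarrow> D \<subseteq> G \<Longrightarrow> disjoint D \<Longrightarrow> \<Union>D \<subseteq> A \<Longrightarrow> (\<Sum>B\<in>D. \<bar>\<mu> B\<bar>) \<in> varsums G \<mu> A"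
  unfolding varsums_def by blast

lemma varsumsE:
  assumes "x \<in> varsums G \<mu> A"
  obtains D where "finite D" "D \<subseteq> G" "disjoint D" "\<Union>D \<subseteq> A" "x = (\<Sum>B\<in>D. \<bar>\<mu> B\<bar>)"
  using assms by (auto simp: varsums_def)

lemma zero_in_varsums: "0 \<in> varsums G \<mu> A"
  using varsumsI[of "{}" G A \<mu>] by simp

section \<open>Finiteness and countable additivity of the total variation\<close>

context sigma_algebra
begin

text \<open>Intersecting with a set may identify members of \<open>D\<close>, but only members that become empty.\<close>

lemma sum_abs_Int_image:
  assumes "finite D" "\<mu> {} = (0::real)" "disjoint D"
  shows "(\<Sum>B\<in>(\<lambda>B. B \<inter> C) ` D. \<bar>\<mu> B\<bar>) = (\<Sum>B\<in>D. \<bar>\<mu> (B \<inter> C)\<bar>)"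
proof -
  have "(\<Sum>B\<in>(\<lambda>B. B \<inter> C) ` D. \<bar>\<mu> B\<bar>) = sum ((\<lambda>B. \<bar>\<mu> B\<bar>) \<circ> (\<lambda>B. B \<inter> C)) D"
  proof (rule sum.reindex_nontrivial[OF assms(1)])
    fix x y assume "x \<in> D" "y \<in> D" "x \<noteq> y" "x \<inter> C = y \<inter> C"
    then have "x \<inter> C = {}" using assms(3) unfolding disjoint_def by blast
    then show "\<bar>\<mu> (x \<inter> C)\<bar> = 0" by (simp add: assms)
  qed
  then show ?thesis by simp
qed

lemma varsums_Int_image:
  assumes "is_sm \<Omega> M \<mu>" "finite D" "D \<subseteq> M" "disjoint D" "C \<in> M" "\<Union>D \<inter> C \<subseteq> A"
  shows "(\<Sum>B\<in>D. \<bar>\<mu> (B \<inter> C)\<bar>) \<in> varsums M \<mu> A"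
proof -
  have "disjoint ((\<lambda>B. B \<inter> C) ` D)" 
    using assms(4) unfolding disjoint_def by blast
  then have "(\<Sum>B\<in>(\<lambda>B. B \<inter> C) ` D. \<bar>\<mu> B\<bar>) \<in> varsums M \<mu> A"
    using assms by (intro varsumsI) auto
  then show ?thesis using sum_abs_Int_image[of D \<mu> C] sm_empty[OF assms(1)] assms by simp
qed

text \<open>Each member C of a family inside the union is cut into \<open>C \<inter> A\<close> and
  \<open>C \<inter> (B - A)\<close>, and the traces form families for A and for B. Used in
  contrapositive form: when a set of unbounded variation is split in two, one part keeps unbounded
  variation.\<close>

lemma bdd_varsums_split:
  assumes sm: "is_sm \<Omega> M \<mu>" and AB: "A \<in> M" "B \<in> M"
    and bdd: "bdd_above (varsums M \<mu> A)" "bdd_above (varsums M \<mu> B)"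
  shows "bdd_above (varsums M \<mu> (A \<union> B))"
proof -
  obtain a where a: "\<And>x. x \<in> varsums M \<mu> A \<Longrightarrow> x \<le> a"
    using bdd(1) by (auto simp: bdd_above_def)
  obtain b where b: "\<And>x. x \<in> varsums M \<mu> B \<Longrightarrow> x \<le> b"
    using bdd(2) by (auto simp: bdd_above_def)
  have "x \<le> a + b" if x: "x \<in> varsums M \<mu> (A \<union> B)" for x
  proof -
    obtain D where D: "finite D" "D \<subseteq> M" "disjoint D" "\<Union>D \<subseteq> A \<union> B" and xe: "x = (\<Sum>C\<in>D. \<bar>\<mu> C\<bar>)"
      using x by (rule varsumsE)
    have "\<bar>\<mu> C\<bar> \<le> \<bar>\<mu> (C \<inter> A)\<bar> + \<bar>\<mu> (C \<inter> (B - A))\<bar>" if "C \<in> D" for C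
    proof -
      have "\<mu> ((C \<inter> A) \<union> (C \<inter> (B - A))) = \<mu> (C \<inter> A) + \<mu> (C \<inter> (B - A))"
        using that D AB by (intro sm_Un[OF sm]) auto
      moreover have "(C \<inter> A) \<union> (C \<inter> (B - A)) = C" using that D(4) by blast
      ultimately show ?thesis by simp
    qed
    then have "x \<le> (\<Sum>C\<in>D. \<bar>\<mu> (C \<inter> A)\<bar>) + (\<Sum>C\<in>D. \<bar>\<mu> (C \<inter> (B - A))\<bar>)"
      unfolding xe sum.distrib[symmetric] by (rule sum_mono)
    also have "\<dots> \<le> a + b"
      using D AB by (intro add_mono a b varsums_Int_image[OF sm]) auto
    finally show ?thesis .
  qed
  then show ?thesis unfolding bdd_above_def by blast
qed

lemma unbounded_varsums_split:
  assumes sm: "is_sm \<Omega> M \<mu>" and E: "E \<in> M" and unb: "\<not> bdd_above (varsums M \<mu> E)"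
  shows "\<exists>A\<in>M. A \<subseteq> E \<and> 1 < \<bar>\<mu> A\<bar> \<and> \<not> bdd_above (varsums M \<mu> (E - A))"
proof -
  \<comment> \<open>The members of negative measure and the others together contribute more than
    twice \<open>1 + \<bar>\<mu> E\<bar>\<close>, so the union of one of the two sorts exceeds
    \<open>1 + \<bar>\<mu> E\<bar>\<close> in absolute value.\<close>
  obtain x where x: "x \<in> varsums M \<mu> E" "2 * (1 + \<bar>\<mu> E\<bar>) < x"
    using unb by (auto simp: bdd_above_def not_le)
  obtain D where D: "finite D" "D \<subseteq> M" "disjoint D" "\<Union>D \<subseteq> E"
      and big: "2 * (1 + \<bar>\<mu> E\<bar>) < (\<Sum>B\<in>D. \<bar>\<mu> B\<bar>)"
    using x by (auto elim!: varsumsE)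
  let ?D1 = "{B\<in>D. 0 \<le> \<mu> B}" and ?D2 = "{B\<in>D. \<mu> B < 0}"
  have "(\<Sum>B\<in>D. \<bar>\<mu> B\<bar>) = (\<Sum>B\<in>?D1 \<union> ?D2. \<bar>\<mu> B\<bar>)"
    by (rule sum.cong) auto
  also have "\<dots> = (\<Sum>B\<in>?D1. \<bar>\<mu> B\<bar>) + (\<Sum>B\<in>?D2. \<bar>\<mu> B\<bar>)"
    using D(1) by (intro sum.union_disjoint) auto
  also have "(\<Sum>B\<in>?D1. \<bar>\<mu> B\<bar>) = \<mu> (\<Union>?D1)"
    using D by (subst sm_Union[OF sm]) (auto simp: disjoint_def)
  also have "(\<Sum>B\<in>?D2. \<bar>\<mu> B\<bar>) = - \<mu> (\<Union>?D2)"
    using D by (subst sm_Union[OF sm]) (auto simp: disjoint_def sum_negf[symmetric] intro!: sum.cong)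
  finally have "(\<Sum>B\<in>D. \<bar>\<mu> B\<bar>) = \<mu> (\<Union>?D1) + - \<mu> (\<Union>?D2)" .
  moreover have "1 + e < \<bar>p\<bar> \<or> 1 + e < \<bar>n\<bar>" if "2 * (1 + e) < p + - n" for p n e :: real
    using that by argo
  ultimately have "1 + \<bar>\<mu> E\<bar> < \<bar>\<mu> (\<Union>?D1)\<bar> \<or> 1 + \<bar>\<mu> E\<bar> < \<bar>\<mu> (\<Union>?D2)\<bar>"
    using big by simp
  moreover have "\<Union>?D1 \<in> M" "\<Union>?D2 \<in> M" "\<Union>?D1 \<subseteq> E" "\<Union>?D2 \<subseteq> E"
    using D by auto
  ultimately obtain A where A: "A \<in> M" "A \<subseteq> E" "1 + \<bar>\<mu> E\<bar> < \<bar>\<mu> A\<bar>"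
    by blast
  \<comment> \<open>The surplus \<open>\<bar>\<mu> E\<bar>\<close> makes the complement exceed 1
    too. Hence whichever of A and E - A keeps unbounded variation, the other one can be cut
    off.\<close>
  have "\<mu> (E - A) = \<mu> E - \<mu> A" using A E by (intro sm_Diff[OF sm])
  then have "1 < \<bar>\<mu> (E - A)\<bar>" "1 < \<bar>\<mu> A\<bar>" using A by linarith+
  moreover have "\<not> bdd_above (varsums M \<mu> (E - A)) \<or> \<not> bdd_above (varsums M \<mu> (E - (E - A)))"
    using bdd_varsums_split[OF sm, of A "E - A"] unb A E
    by (auto simp: Un_absorb1 double_diff Diff)
  moreover have "E - A \<in> M" using A E by blast
  ultimately show ?thesis using A by (metis Diff_subset)
qed

text \<open>Repeated splitting gives a decreasing sequence whose successive differences are disjoint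
  and all of measure above 1 in absolute value, but the series of their measures converges. An
  arbitrary A reduces to \<Omega>, since all members of a family lie in \<Omega>.\<close>

lemma bdd_varsums: 
  assumes sm: "is_sm \<Omega> M \<mu>"
  shows "bdd_above (varsums M \<mu> A)"
proof (rule ccontr)
  assume unb: "\<not> bdd_above (varsums M \<mu> A)"
  have "varsums M \<mu> A \<subseteq> varsums M \<mu> \<Omega>"
  proof
    fix x assume "x \<in> varsums M \<mu> A"
    then obtain D where D: "finite D" "D \<subseteq> M" "disjoint D" "x = (\<Sum>B\<in>D. \<bar>\<mu> B\<bar>)"
      by (rule varsumsE)
    show "x \<in> varsums M \<mu> \<Omega>"
      unfolding D(4) using D sets_into_space by (intro varsumsI) auto
  qed
  then have unb0: "\<not> bdd_above (varsums M \<mu> \<Omega>)"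
    by (intro contrapos_nn[OF unb]) (rule bdd_above_mono)
  define bad where "bad E \<longleftrightarrow> E \<in> M \<and> \<not> bdd_above (varsums M \<mu> E)" for E
  have "\<exists>E. E 0 = \<Omega> \<and> (\<forall>n::nat. bad (E n) \<and> (E (Suc n) \<subseteq> E n \<and> 1 < \<bar>\<mu> (E n - E (Suc n))\<bar>))"
  proof (rule exE[OF dependent_nat_choice[of "\<lambda>n E. bad E \<and> (n = 0 \<longrightarrow> E = \<Omega>)"
        "\<lambda>n E E'. E' \<subseteq> E \<and> 1 < \<bar>\<mu> (E - E')\<bar>"]], goal_cases)
    case 1
    then show ?case using unb0 by (auto simp: bad_def)
  next
    case (2 E n)
    then obtain A where "A \<in> M" "A \<subseteq> E" "1 < \<bar>\<mu> A\<bar>" "\<not> bdd_above (varsums M \<mu> (E - A))"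
      using unbounded_varsums_split[OF sm, of E] unfolding bad_def by auto
    moreover have "E - (E - A) = A" using \<open>A \<subseteq> E\<close> by blast
    ultimately show ?case using 2 by (intro exI[of _ "E - A"]) (auto simp: bad_def)
  next
    case 3
    then show ?case by blast
  qed
  then obtain E :: "nat \<Rightarrow> 'a set" where E: "\<And>n. bad (E n)" "\<And>n. E (Suc n) \<subseteq> E n"
      "\<And>n. 1 < \<bar>\<mu> (E n - E (Suc n))\<bar>"
    by blast
  define X where "X n = E n - E (Suc n)" for n
  have mono: "E n \<subseteq> E m" if "m \<le> n" for m n
    using lift_Suc_antimono_le[of E, OF E(2) that] .
  have "disjoint_family X"
    unfolding disjoint_family_on_def X_def
  proof (intro ballI impI)
    fix m n :: nat assume "m \<noteq> n"
    then consider "Suc m \<le> n" | "Suc n \<le> m" by linarith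
    then show "(E m - E (Suc m)) \<inter> (E n - E (Suc n)) = {}"
      using mono by cases blast+
  qed
  moreover have "range X \<subseteq> M" using E(1) by (auto simp: X_def bad_def)
  ultimately have "(\<lambda>i. \<mu> (X i)) sums \<mu> (\<Union>i. X i)" using sm_sums[OF sm] by simp
  then have "(\<lambda>i. \<mu> (X i)) \<longlonglongrightarrow> 0" by (intro summable_LIMSEQ_zero sums_summable)
  then have "eventually (\<lambda>i. dist (\<mu> (X i)) 0 < 1) sequentially"
    by (intro tendstoD) auto
  then obtain n where "\<bar>\<mu> (X n)\<bar> < 1" by (auto simp: eventually_sequentially)
  with E(3)[of n] show False unfolding X_def by linarith
qed

lemma sum_le_tv:
  assumes "is_sm \<Omega> M \<mu>" "finite D" "D \<subseteq> M" "disjoint D" "\<Union>D \<subseteq> A"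
  shows "(\<Sum>B\<in>D. \<bar>\<mu> B\<bar>) \<le> tv M \<mu> A"
  unfolding tv_eq_Sup using assms by (intro cSup_upper varsumsI bdd_varsums)

lemma tv_le:
  assumes "\<And>D. finite D \<Longrightarrow> D \<subseteq> M \<Longrightarrow> disjoint D \<Longrightarrow> \<Union>D \<subseteq> A \<Longrightarrow> (\<Sum>B\<in>D. \<bar>\<mu> B\<bar>) \<le> c"
  shows "tv M \<mu> A \<le> c"
  unfolding tv_eq_Sup
proof (rule cSup_least)
  show "varsums M \<mu> A \<noteq> {}" using zero_in_varsums by blast
qed (auto simp: varsums_def intro: assms)

lemma abs_le_tv: "is_sm \<Omega> M \<mu> \<Longrightarrow> B \<in> M \<Longrightarrow> B \<subseteq> A \<Longrightarrow> \<bar>\<mu> B\<bar> \<le> tv M \<mu> A"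
  using sum_le_tv[of \<mu> "{B}" A] by (auto simp: disjoint_def)

lemma tv_nonneg: "is_sm \<Omega> M \<mu> \<Longrightarrow> 0 \<le> tv M \<mu> A"
  using sum_le_tv[of \<mu> "{}" A] by simp

lemma tv_mono: "is_sm \<Omega> M \<mu> \<Longrightarrow> A \<subseteq> B \<Longrightarrow> tv M \<mu> A \<le> tv M \<mu> B"
  by (rule tv_le, rule sum_le_tv) auto

lemma tv_eq_0_iff:
  assumes "is_sm \<Omega> M \<mu>"
  shows "tv M \<mu> A = 0 \<longleftrightarrow> (\<forall>B\<in>M. B \<subseteq> A \<longrightarrow> \<mu> B = 0)"
proof
  assume "\<forall>B\<in>M. B \<subseteq> A \<longrightarrow> \<mu> B = 0"
  then have "tv M \<mu> A \<le> 0" by (intro tv_le sum_nonpos) (simp, blast)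
  then show "tv M \<mu> A = 0" using tv_nonneg[OF assms, of A] by simp
qed (use abs_le_tv[OF assms, of _ A] in force)

text \<open>A family for A and one for B combine to a family for the union; the supremum is then
  taken over one of them at a time.\<close>

lemma tv_Un_ge:
  assumes sm: "is_sm \<Omega> M \<mu>" and disj: "A \<inter> B = {}"
  shows "tv M \<mu> A + tv M \<mu> B \<le> tv M \<mu> (A \<union> B)"
proof -
  have *: "(\<Sum>C\<in>D. \<bar>\<mu> C\<bar>) + (\<Sum>C\<in>E. \<bar>\<mu> C\<bar>) \<le> tv M \<mu> (A \<union> B)"
    if D: "finite D" "D \<subseteq> M" "disjoint D" "\<Union>D \<subseteq> A" and E: "finite E" "E \<subseteq> M" "disjoint E" "\<Union>E \<subseteq> B" for D E
  proof -
    \<comment> \<open>The two families can share only the empty set, so no value is counted once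
      instead of twice.\<close>
    have "D \<inter> E \<subseteq> {{}}" using D E disj by blast
    then have "(\<Sum>C\<in>D \<inter> E. \<bar>\<mu> C\<bar>) = 0"
      using sm_empty[OF sm] by (intro sum.neutral) auto
    then have "(\<Sum>C\<in>D. \<bar>\<mu> C\<bar>) + (\<Sum>C\<in>E. \<bar>\<mu> C\<bar>) = (\<Sum>C\<in>D \<union> E. \<bar>\<mu> C\<bar>)"
      using sum.union_inter[OF D(1) E(1), of "\<lambda>C. \<bar>\<mu> C\<bar>"] by simp
    also have "\<dots> \<le> tv M \<mu> (A \<union> B)"
    proof (rule sum_le_tv[OF sm])
      show "disjoint (D \<union> E)" 
        using D E disj by (intro disjoint_union) blast+
    qed (use D E in auto)
    finally show ?thesis .
  qed
  have "tv M \<mu> A \<le> tv M \<mu> (A \<union> B) - tv M \<mu> B"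
  proof (rule tv_le)
    fix D assume D: "finite D" "D \<subseteq> M" "disjoint D" "\<Union>D \<subseteq> A"
    have "tv M \<mu> B \<le> tv M \<mu> (A \<union> B) - (\<Sum>C\<in>D. \<bar>\<mu> C\<bar>)"
      by (rule tv_le) (use *[OF D] in \<open>simp add: algebra_simps\<close>)
    then show "(\<Sum>C\<in>D. \<bar>\<mu> C\<bar>) \<le> tv M \<mu> (A \<union> B) - tv M \<mu> B" by simp
  qed
  then show ?thesis by simp
qed

lemma sum_tv_le:
  assumes sm: "is_sm \<Omega> M \<mu>" and disj: "disjoint_family A"
  shows "(\<Sum>i<n. tv M \<mu> (A i)) \<le> tv M \<mu> (\<Union>i<n::nat. A i)"
proof (induction n)
  case 0
  then show ?case using tv_nonneg[OF sm] by simp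
next
  case (Suc n)
  have "(\<Union>i<n. A i) \<inter> A n = {}"
    using disj by (auto simp: disjoint_family_on_def) (metis IntI emptyE less_irrefl)
  from tv_Un_ge[OF sm this] Suc show ?case by (simp add: lessThan_Suc Un_commute)
qed

text \<open>One inequality is the limit of superadditivity. For the other, every member of a finite
  family is cut along the A i, and the finite sum is exchanged with the series. \<open>restr\<close>
  supplies the value 0 outside M that \<open>is_sm\<close> demands, where \<open>tv\<close> itself
  need not vanish.\<close>

lemma is_sm_tv:
  assumes sm: "is_sm \<Omega> M \<mu>"
  shows "is_sm \<Omega> M (restr M (tv M \<mu>))"
proof (rule is_smI)
  fix A :: "nat \<Rightarrow> 'a set" assume A: "range A \<subseteq> M" "disjoint_family A"
  let ?U = "\<Union>i. A i"
  have U: "?U \<in> M" using A by blast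
  have le: "(\<Sum>i<n. tv M \<mu> (A i)) \<le> tv M \<mu> ?U" for n
    by (rule order_trans[OF sum_tv_le[OF sm A(2)] tv_mono[OF sm]]) auto
  have smm: "summable (\<lambda>i. tv M \<mu> (A i))"
    using le tv_nonneg[OF sm] by (intro summableI_nonneg_bounded) auto
  have "tv M \<mu> ?U \<le> (\<Sum>i. tv M \<mu> (A i))"
  proof (rule tv_le)
    fix D assume D: "finite D" "D \<subseteq> M" "disjoint D" "\<Union>D \<subseteq> ?U"
    have abs_sum: "summable (\<lambda>i. \<bar>\<mu> (C \<inter> A i)\<bar>)" and abs_le: "\<bar>\<mu> C\<bar> \<le> (\<Sum>i. \<bar>\<mu> (C \<inter> A i)\<bar>)"
      if C: "C \<in> D" for C
    proof -
      have sub: "C \<inter> A i \<in> M" for i using C D(2) A(1) by (intro Int) auto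
      show s: "summable (\<lambda>i. \<bar>\<mu> (C \<inter> A i)\<bar>)"
        by (rule summable_comparison_test'[OF smm]) (auto intro!: abs_le_tv sm sub)
      have "disjoint_family (\<lambda>i. C \<inter> A i)" using A(2) by (auto simp: disjoint_family_on_def)
      moreover have "range (\<lambda>i. C \<inter> A i) \<subseteq> M" using sub by blast
      ultimately have "(\<lambda>i. \<mu> (C \<inter> A i)) sums \<mu> (\<Union>i. C \<inter> A i)" 
        by (rule sm_sums[OF sm, rotated])
      moreover have "(\<Union>i. C \<inter> A i) = C" using C D(4) by blast
      ultimately have "\<mu> C = (\<Sum>i. \<mu> (C \<inter> A i))" by (simp add: sums_iff)
      then show "\<bar>\<mu> C\<bar> \<le> (\<Sum>i. \<bar>\<mu> (C \<inter> A i)\<bar>)"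
        using summable_rabs[OF s] by simp
    qed
    have "(\<Sum>C\<in>D. \<bar>\<mu> C\<bar>) \<le> (\<Sum>C\<in>D. \<Sum>i. \<bar>\<mu> (C \<inter> A i)\<bar>)"
      by (rule sum_mono) (rule abs_le)
    also have "\<dots> = (\<Sum>i. \<Sum>C\<in>D. \<bar>\<mu> (C \<inter> A i)\<bar>)"
      by (rule suminf_sum[symmetric]) (rule abs_sum)
    also have "\<dots> \<le> (\<Sum>i. tv M \<mu> (A i))"
    proof (rule suminf_le)
      show "(\<Sum>C\<in>D. \<bar>\<mu> (C \<inter> A i)\<bar>) \<le> tv M \<mu> (A i)" for i
        unfolding tv_eq_Sup using D A
        by (intro cSup_upper varsums_Int_image[OF sm] bdd_varsums[OF sm]) auto
    qed (auto intro: smm summable_sum abs_sum)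
    finally show "(\<Sum>B\<in>D. \<bar>\<mu> B\<bar>) \<le> (\<Sum>i. tv M \<mu> (A i))" .
  qed
  moreover have "(\<Sum>i. tv M \<mu> (A i)) \<le> tv M \<mu> ?U"
    by (rule suminf_le_const[OF smm le])
  ultimately have "(\<lambda>i. tv M \<mu> (A i)) sums tv M \<mu> ?U"
    using smm by (simp add: sums_iff)
  moreover have "A i \<in> M" for i using A by blast
  ultimately show "(\<lambda>i. restr M (tv M \<mu>) (A i)) sums restr M (tv M \<mu>) ?U"
    using U by (simp add: restr_def)
qed (simp add: restr_def)

text \<open>Any enumeration gives a series; absolute convergence makes it an unordered sum.\<close>

lemma sm_has_sum:
  assumes sm: "is_sm \<Omega> M \<mu>" and K: "countable K" and A: "\<And>k. k \<in> K \<Longrightarrow> A k \<in> M"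
    and disj: "disjoint_family_on A K"
  shows "((\<lambda>k. \<mu> (A k)) has_sum \<mu> (\<Union>k\<in>K. A k)) K"
proof -
  let ?t = "to_nat_on K"
  have inj: "inj_on ?t K" by (rule inj_on_to_nat_on[OF K])
  \<comment> \<open>Numbers that enumerate no index get the empty set, so that a sequence indexed by
    all naturals arises.\<close>
  define B where "B n = (if n \<in> ?t ` K then A (inv_into K ?t n) else {})" for n
  have Bt: "B (?t k) = A k" if "k \<in> K" for k using that inj by (simp add: B_def)
  have B: "range B \<subseteq> M" using A by (auto simp: B_def inv_into_into)
  have "disjoint_family B"
    unfolding disjoint_family_on_def
  proof (intro ballI impI)
    fix m n :: nat assume "m \<noteq> n"
    show "B m \<inter> B n = {}"
    proof (cases "m \<in> ?t ` K \<and> n \<in> ?t ` K")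
      case True
      then obtain k l where "k \<in> K" "l \<in> K" "m = ?t k" "n = ?t l" by blast
      then show ?thesis using Bt \<open>m \<noteq> n\<close> disj by (metis disjoint_family_onD)
    qed (auto simp: B_def)
  qed
  then have "(\<lambda>n. \<mu> (B n)) sums \<mu> (\<Union>n. B n)" "(\<lambda>n. restr M (tv M \<mu>) (B n)) sums restr M (tv M \<mu>) (\<Union>n. B n)"
    using B sm_sums[OF sm] sm_sums[OF is_sm_tv[OF sm]] by simp_all
  \<comment> \<open>Absolute summability holds because the total variation is countably additive
    itself and dominates term by term.\<close>
  moreover from this(2) have "summable (\<lambda>n. norm (\<mu> (B n)))"
    using B by (intro summable_comparison_test'[OF sums_summable])
      (auto simp: restr_def range_subsetD intro!: abs_le_tv[OF sm])
  ultimately have "((\<lambda>n. \<mu> (B n)) has_sum \<mu> (\<Union>n. B n)) UNIV"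
    by (intro norm_summable_imp_has_sum)
  moreover have "(\<Union>n. B n) = (\<Union>k\<in>K. A k)"
  proof (intro subset_antisym UN_least)
    show "B n \<subseteq> (\<Union>k\<in>K. A k)" for n
      using A by (auto simp: B_def inj)
    show "A k \<subseteq> (\<Union>n. B n)" if "k \<in> K" for k using Bt[OF that] by blast
  qed
  ultimately have "((\<lambda>n. \<mu> (B n)) has_sum \<mu> (\<Union>k\<in>K. A k)) (?t ` K)"
    using sm_empty[OF sm] by (subst has_sum_cong_neutral[of UNIV _ _ "\<lambda>n. \<mu> (B n)"]) (auto simp: B_def)
  then have "(((\<lambda>n. \<mu> (B n)) \<circ> ?t) has_sum \<mu> (\<Union>k\<in>K. A k)) K"
    by (subst (asm) has_sum_reindex[OF inj])
  then show ?thesis by (rule has_sum_cong[THEN iffD1, rotated]) (simp add: Bt)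
qed

end

section \<open>Densities and integration against signed measures\<close>

definition sm_measure :: "'a set \<Rightarrow> 'a set set \<Rightarrow> 'a sm \<Rightarrow> 'a measure" where
  "sm_measure \<Omega> G R = measure_of \<Omega> G (\<lambda>A. ennreal (R A))"

definition density_sm :: "'a measure \<Rightarrow> ('a \<Rightarrow> real) \<Rightarrow> 'a sm" where
  "density_sm N h A = (if A \<in> sets N then (\<integral>x. h x * indicator A x \<partial>N) else 0)"

text \<open>The upper part (|\<nu>| + \<nu>) / 2 of the Jordan decomposition. As \<open>tv\<close>
  ignores the sign, applying it to -\<nu> yields the lower part, and no Hahn set has to be
  chosen.\<close>

definition pos_part :: "'a set set \<Rightarrow> 'a sm \<Rightarrow> 'a sm" where
  "pos_part G \<nu> = restr G (\<lambda>A. (tv G \<nu> A + \<nu> A) / 2)"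

definition sm_integral :: "'a set \<Rightarrow> 'a set set \<Rightarrow> ('a \<Rightarrow> real) \<Rightarrow> 'a sm \<Rightarrow> real" where
  "sm_integral \<Omega> G f \<nu> = (\<integral>x. f x \<partial>sm_measure \<Omega> G (pos_part G \<nu>)) - (\<integral>x. f x \<partial>sm_measure \<Omega> G (pos_part G (\<lambda>A. - \<nu> A)))"

lemma tv_uminus [simp]: "tv G (\<lambda>A. - \<mu> A) = tv G \<mu>"
  by (simp add: tv_def fun_eq_iff)

section \<open>Nonnegative set functions as measures\<close>

context sigma_algebra
begin

lemma sm_mono:
  assumes "is_sm \<Omega> M R" "\<forall>A\<in>M. 0 \<le> R A" "A \<in> M" "B \<in> M" "B \<subseteq> A"
  shows "R B \<le> R A"
  using sm_Diff[OF assms(1,3-5)] assms(2) Diff[OF assms(3,4)] by force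

text \<open>Nonnegativity of R makes subsets of R-null sets R-null, so \<nu> vanishing on null sets
  also vanishes on all their measurable subsets, which is vanishing of its variation.\<close>

lemma abs_cont_iff:
  assumes "is_sm \<Omega> M \<nu>" "is_sm \<Omega> M R" "\<forall>A\<in>M. 0 \<le> R A"
  shows "abs_cont M \<nu> R \<longleftrightarrow> (\<forall>A\<in>M. R A = 0 \<longrightarrow> \<nu> A = 0)"
proof
  assume *: "\<forall>A\<in>M. R A = 0 \<longrightarrow> \<nu> A = 0"
  show "abs_cont M \<nu> R"
    unfolding abs_cont_def tv_eq_0_iff[OF assms(1)]
  proof (intro ballI impI)
    fix A B assume "A \<in> M" "R A = 0" "B \<in> M" "B \<subseteq> A"
    then have "R B = 0" using sm_mono[OF assms(2,3), of A B] assms(3) by force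
    then show "\<nu> B = 0" using * \<open>B \<in> M\<close> by simp
  qed
qed (auto simp: abs_cont_def tv_eq_0_iff[OF assms(1)])

lemma space_sm_measure [simp]: "space (sm_measure \<Omega> M R) = \<Omega>"
  by (simp add: sm_measure_def space_closed)

lemma sets_sm_measure [simp]: "sets (sm_measure \<Omega> M R) = M"
  by (simp add: sm_measure_def space_closed sets_measure_of sigma_sets_eq)

lemma emeasure_sm_measure:
  assumes sm: "is_sm \<Omega> M R" and nn: "\<forall>A\<in>M. 0 \<le> R A" and A: "A \<in> M"
  shows "emeasure (sm_measure \<Omega> M R) A = ennreal (R A)"
  unfolding sm_measure_def
proof (rule emeasure_measure_of_sigma)
  show "countably_additive M (\<lambda>A. ennreal (R A))"
  proof (rule countably_additiveI)
    fix B :: "nat \<Rightarrow> 'a set" assume B: "range B \<subseteq> M" "disjoint_family B" "\<Union>(range B) \<in> M"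
    have "(\<lambda>i. R (B i)) sums R (\<Union>i. B i)" using sm_sums[OF sm B(1,2)] .
    moreover have "0 \<le> R (B i)" for i using B nn by auto
    ultimately have "(\<lambda>i. ennreal (R (B i))) sums ennreal (R (\<Union>i. B i))"
      using B(3) nn by (subst sums_ennreal) auto
    then show "(\<Sum>i. ennreal (R (B i))) = ennreal (R (\<Union> (range B)))"
      by (simp add: sums_iff)
  qed
qed (use A sm_empty[OF sm] in \<open>auto simp: positive_def intro: sigma_algebra_axioms\<close>)

lemma finite_measure_sm_measure:
  assumes "is_sm \<Omega> M R" "\<forall>A\<in>M. 0 \<le> R A"
  shows "finite_measure (sm_measure \<Omega> M R)"
  by (rule finite_measureI) (simp add: emeasure_sm_measure[OF assms])

lemma measure_sm_measure:
  assumes "is_sm \<Omega> M R" "\<forall>A\<in>M. 0 \<le> R A" "A \<in> M"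
  shows "measure (sm_measure \<Omega> M R) A = R A"
  using assms by (simp add: measure_def emeasure_sm_measure)

end

section \<open>Signed measures with an integrable density\<close>

lemma density_sm_lincomb:
  assumes "integrable N h" "integrable N g"
  shows "density_sm N (\<lambda>x. a * h x + b * g x) = (\<lambda>A. a * density_sm N h A + b * density_sm N g A)"
proof
  fix A
  show "density_sm N (\<lambda>x. a * h x + b * g x) A = a * density_sm N h A + b * density_sm N g A"
  proof (cases "A \<in> sets N")
    case True
    have "integrable N (\<lambda>x. h x * indicator A x)" "integrable N (\<lambda>x. g x * indicator A x)"
      using assms True by (auto intro: integrable_real_mult_indicator)
    then show ?thesis using True by (simp add: density_sm_def algebra_simps)
  qed (simp add: density_sm_def)
qed

lemma is_sm_density_sm:
  assumes h: "integrable N h"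
  shows "is_sm \<Omega> (sets N) (density_sm N h)"
proof (rule is_smI)
  fix A :: "nat \<Rightarrow> 'a set" assume A: "range A \<subseteq> sets N" "disjoint_family A"
  have Ai [measurable]: "A i \<in> sets N" for i using A by auto
  have [measurable]: "h \<in> borel_measurable N" using h by simp
  have "(\<lambda>n. \<integral>x. h x * indicator (\<Union>i<n. A i) x \<partial>N) \<longlonglongrightarrow> (\<integral>x. h x * indicator (\<Union>i. A i) x \<partial>N)"
  proof (rule integral_dominated_convergence[where w="\<lambda>x. \<bar>h x\<bar>"])
    show "AE x in N. (\<lambda>n. h x * indicator (\<Union>i<n. A i) x) \<longlonglongrightarrow> h x * indicator (\<Union>i. A i) x"
      by (intro AE_I2 tendsto_mult_left LIMSEQ_indicator_UN)
  qed (use h in \<open>auto simp: indicator_def\<close>)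
  moreover have "(\<integral>x. h x * indicator (\<Union>i<n. A i) x \<partial>N) = (\<Sum>i<n. density_sm N h (A i))" for n
  proof -
    have "(\<integral>x. h x * indicator (\<Union>i<n. A i) x \<partial>N) = (\<integral>x. (\<Sum>i<n. h x * indicator (A i) x) \<partial>N)"
      using A(2) by (subst indicator_UN_disjoint) (auto simp: sum_distrib_left disjoint_family_on_def)
    also have "\<dots> = (\<Sum>i<n. \<integral>x. h x * indicator (A i) x \<partial>N)"
      using h by (intro Bochner_Integration.integral_sum integrable_real_mult_indicator) auto
    finally show ?thesis by (simp add: density_sm_def)
  qed
  moreover have "(\<Union>i. A i) \<in> sets N" by measurable
  ultimately show "(\<lambda>i. density_sm N h (A i)) sums density_sm N h (\<Union>i. A i)"
    by (simp add: sums_def density_sm_def)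
qed (simp add: density_sm_def)

lemma density_sm_nonneg: "(\<And>x. 0 \<le> h x) \<Longrightarrow> 0 \<le> density_sm N h A"
  by (simp add: density_sm_def)

lemma abs_density_sm_le:
  assumes "integrable N h"
  shows "\<bar>density_sm N h A\<bar> \<le> density_sm N (\<lambda>x. \<bar>h x\<bar>) A"
  using integral_abs_bound[of N "\<lambda>x. h x * indicator A x"] by (auto simp: density_sm_def abs_mult)

text \<open>The upper bound is the triangle inequality for integrals. The lower bound uses just two
  sets, the part of A where h is nonnegative and the rest, on each of which h has constant
  sign.\<close>

lemma tv_density_sm:
  assumes h: "integrable N h" and A: "A \<in> sets N"
  shows "tv (sets N) (density_sm N h) A = density_sm N (\<lambda>x. \<bar>h x\<bar>) A"
proof (rule antisym)
  have [measurable]: "h \<in> borel_measurable N" using h by simp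
  have h': "integrable N (\<lambda>x. \<bar>h x\<bar>)" using h by simp
  note sm = is_sm_density_sm[OF h, of "space N"] and sm' = is_sm_density_sm[OF h', of "space N"]
  show "tv (sets N) (density_sm N h) A \<le> density_sm N (\<lambda>x. \<bar>h x\<bar>) A"
  proof (rule sets.tv_le)
    fix D assume D: "finite D" "D \<subseteq> sets N" "disjoint D" "\<Union>D \<subseteq> A"
    have "(\<Sum>B\<in>D. \<bar>density_sm N h B\<bar>) \<le> (\<Sum>B\<in>D. density_sm N (\<lambda>x. \<bar>h x\<bar>) B)"
      by (intro sum_mono abs_density_sm_le h)
    also have "\<dots> = density_sm N (\<lambda>x. \<bar>h x\<bar>) (\<Union>D)"
      by (rule sets.sm_Union[OF sm' D(1-3), symmetric])
    also have "\<dots> \<le> density_sm N (\<lambda>x. \<bar>h x\<bar>) A"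
      using D A by (intro sets.sm_mono[OF sm']) (auto simp: density_sm_nonneg)
    finally show "(\<Sum>B\<in>D. \<bar>density_sm N h B\<bar>) \<le> density_sm N (\<lambda>x. \<bar>h x\<bar>) A" .
  qed
  define P where "P = {x\<in>space N. 0 \<le> h x} \<inter> A"
  have P [measurable]: "P \<in> sets N" using A by (simp add: P_def)
  have A' [measurable]: "A - P \<in> sets N" using A P by auto
  have "density_sm N (\<lambda>x. \<bar>h x\<bar>) A = density_sm N h P - density_sm N h (A - P)"
  proof -
    have "density_sm N h P - density_sm N h (A - P) = (\<integral>x. h x * indicator P x - h x * indicator (A - P) x \<partial>N)"
      unfolding density_sm_def using P A' h
      by (simp, intro Bochner_Integration.integral_diff[symmetric] integrable_real_mult_indicator) auto
    also have "\<dots> = (\<integral>x. \<bar>h x\<bar> * indicator A x \<partial>N)"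
      using sets.sets_into_space[OF A]
      by (intro Bochner_Integration.integral_cong) (auto simp: P_def indicator_def)
    finally show ?thesis using A by (simp add: density_sm_def)
  qed
  also have "\<dots> \<le> \<bar>density_sm N h P\<bar> + \<bar>density_sm N h (A - P)\<bar>" by simp
  also have "\<dots> \<le> tv (sets N) (density_sm N h) P + tv (sets N) (density_sm N h) (A - P)"
    by (intro add_mono sets.abs_le_tv[OF sm]) (use P A' in auto)
  also have "\<dots> \<le> tv (sets N) (density_sm N h) (P \<union> (A - P))"
    by (intro sets.tv_Un_ge[OF sm]) auto
  also have "P \<union> (A - P) = A" by (auto simp: P_def)
  finally show "density_sm N (\<lambda>x. \<bar>h x\<bar>) A \<le> tv (sets N) (density_sm N h) A" .
qed

lemma tvnorm_density_sm:
  assumes "integrable N h"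
  shows "tvnorm (space N) (sets N) (density_sm N h) = (\<integral>x. \<bar>h x\<bar> \<partial>N)"
  by (simp add: tvnorm_def tv_density_sm[OF assms] density_sm_def cong: Bochner_Integration.integral_cong)

lemma sm_measure_density_sm:
  assumes h: "integrable N h" and nn: "\<And>x. 0 \<le> h x"
  shows "sm_measure (space N) (sets N) (density_sm N h) = density N (\<lambda>x. ennreal (h x))"
proof (rule measure_eqI)
  fix A assume "A \<in> sets (sm_measure (space N) (sets N) (density_sm N h))"
  then have A [measurable]: "A \<in> sets N" by simp
  have [measurable]: "h \<in> borel_measurable N" using h by simp
  have "emeasure (density N (\<lambda>x. ennreal (h x))) A = (\<integral>\<^sup>+x. ennreal (h x * indicator A x) \<partial>N)"
    by (subst emeasure_density) (auto intro!: nn_integral_cong simp: indicator_def)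
  also have "\<dots> = ennreal (density_sm N h A)"
    using h A nn by (subst nn_integral_eq_integral)
      (auto simp: density_sm_def intro!: integrable_real_mult_indicator)
  finally show "emeasure (sm_measure (space N) (sets N) (density_sm N h)) A = emeasure (density N (\<lambda>x. ennreal (h x))) A"
    using sets.emeasure_sm_measure[OF is_sm_density_sm[OF h] _ A] nn by (simp add: density_sm_nonneg)
qed simp

lemma pos_part_density_sm:
  assumes "integrable N h"
  shows "pos_part (sets N) (density_sm N h) = density_sm N (\<lambda>x. (\<bar>h x\<bar> + h x) / 2)"
proof -
  have "density_sm N (\<lambda>x. 1/2 * \<bar>h x\<bar> + 1/2 * h x) = (\<lambda>A. 1/2 * density_sm N (\<lambda>x. \<bar>h x\<bar>) A + 1/2 * density_sm N h A)"
    using assms by (intro density_sm_lincomb) auto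
  then show ?thesis
    by (auto simp: pos_part_def restr_def fun_eq_iff tv_density_sm[OF assms] add_divide_distrib) (simp_all add: density_sm_def)
qed

text \<open>The integrand \<open>f x * \<bar>h x\<bar>\<close> is rewritten as
  \<open>\<bar>f x * h x\<bar> * sgn (f x)\<close>, so integrability of both Jordan terms follows
  from that of the product of f and h alone. The terms with the absolute value cancel in the
  difference.\<close>

lemma sm_integral_density_sm:
  assumes f: "f \<in> borel_measurable N" and h: "integrable N h" and fh: "integrable N (\<lambda>x. f x * h x)"
  shows "sm_integral (space N) (sets N) f (density_sm N h) = (\<integral>x. f x * h x \<partial>N)"
proof -
  have *: "(\<integral>x. f x \<partial>sm_measure (space N) (sets N) (pos_part (sets N) (density_sm N h))) = (\<integral>x. (\<bar>f x * h x\<bar> * sgn (f x) + f x * h x) / 2 \<partial>N)"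
    if h: "integrable N h" for h
  proof -
    have [measurable]: "h \<in> borel_measurable N" using h by simp
    have "(\<integral>x. f x \<partial>sm_measure (space N) (sets N) (pos_part (sets N) (density_sm N h))) = (\<integral>x. ((\<bar>h x\<bar> + h x) / 2) *\<^sub>R f x \<partial>N)"
      unfolding pos_part_density_sm[OF h] using h f by (subst sm_measure_density_sm, simp, simp, subst integral_density) auto
    also have "\<dots> = (\<integral>x. (\<bar>f x * h x\<bar> * sgn (f x) + f x * h x) / 2 \<partial>N)"
      by (intro Bochner_Integration.integral_cong) (auto simp: abs_mult algebra_simps abs_mult_sgn mult_sgn_abs)
    finally show ?thesis .
  qed
  have neg: "(\<lambda>A. - density_sm N h A) = density_sm N (\<lambda>x. - h x)"
    using density_sm_lincomb[OF h h, of "-1" 0] by simp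
  have "sgn \<circ> f \<in> borel_measurable N" using f by (simp add: comp_def)
  then have s [measurable]: "(\<lambda>x. sgn (f x)) \<in> borel_measurable N" by (simp add: comp_def)
  have i: "integrable N (\<lambda>x. \<bar>f x * h x\<bar> * sgn (f x))"
    by (rule Bochner_Integration.integrable_bound[OF fh])
      (use fh f h in \<open>auto simp: abs_mult sgn_if\<close>)
  show ?thesis
    unfolding sm_integral_def neg *[OF h] using *[of "\<lambda>x. - h x"] h i fh by (simp add: field_simps)
qed

section \<open>Radon-Nikodym densities of signed measures\<close>

context sigma_algebra
begin

text \<open>The Radon-Nikodym theorem; finiteness of p allows a derivative that is real and
  nonnegative at every point, and its integrability is finiteness of
  \<open>p \<Omega>\<close>.\<close>

lemma nonneg_sm_density:
  assumes p: "is_sm \<Omega> M p" "\<forall>A\<in>M. 0 \<le> p A" and R: "is_sm \<Omega> M R" "\<forall>A\<in>M. 0 \<le> R A"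
    and ac: "\<And>A. A \<in> M \<Longrightarrow> R A = 0 \<Longrightarrow> p A = 0"
  obtains h where "integrable (sm_measure \<Omega> M R) h" "p = density_sm (sm_measure \<Omega> M R) h"
proof -
  interpret R: finite_measure "sm_measure \<Omega> M R" by (rule finite_measure_sm_measure[OF R])
  have ac': "absolutely_continuous (sm_measure \<Omega> M R) (sm_measure \<Omega> M p)"
    unfolding absolutely_continuous_def
    using ac R(2) by (auto simp: null_sets_def emeasure_sm_measure[OF p] emeasure_sm_measure[OF R] ennreal_eq_0_iff)
  obtain D where D [measurable]: "D \<in> borel_measurable (sm_measure \<Omega> M R)"
    and AE: "AE x in sm_measure \<Omega> M R. RN_deriv (sm_measure \<Omega> M R) (sm_measure \<Omega> M p) x = ennreal (D x)"
    and nn: "\<And>x. 0 \<le> D x"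
    using R.real_RN_deriv[OF finite_measure_sm_measure[OF p] ac'] by (metis sets_sm_measure)
  have dens: "sm_measure \<Omega> M p = density (sm_measure \<Omega> M R) (\<lambda>x. ennreal (D x))"
  proof -
    have "sm_measure \<Omega> M p = density (sm_measure \<Omega> M R) (RN_deriv (sm_measure \<Omega> M R) (sm_measure \<Omega> M p))"
      using R.density_RN_deriv[OF ac'] by simp
    also have "\<dots> = density (sm_measure \<Omega> M R) (\<lambda>x. ennreal (D x))"
      using AE by (intro density_cong) auto
    finally show ?thesis .
  qed
  have nnint: "(\<integral>\<^sup>+x. ennreal (D x * indicator A x) \<partial>sm_measure \<Omega> M R) = ennreal (p A)" if "A \<in> M" for A
  proof -
    have "ennreal (p A) = emeasure (density (sm_measure \<Omega> M R) (\<lambda>x. ennreal (D x))) A"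
      using that by (simp add: dens[symmetric] emeasure_sm_measure[OF p])
    also have "\<dots> = (\<integral>\<^sup>+x. ennreal (D x * indicator A x) \<partial>sm_measure \<Omega> M R)"
      using that by (subst emeasure_density) (auto intro!: nn_integral_cong simp: indicator_def)
    finally show ?thesis by simp
  qed
  have "(\<integral>\<^sup>+x. ennreal (D x) \<partial>sm_measure \<Omega> M R) = (\<integral>\<^sup>+x. ennreal (D x * indicator \<Omega> x) \<partial>sm_measure \<Omega> M R)"
    by (intro nn_integral_cong) simp
  then have int: "integrable (sm_measure \<Omega> M R) D"
    using nnint[OF top] nn by (intro integrableI_nonneg) auto
  have "p A = density_sm (sm_measure \<Omega> M R) D A" for A
  proof (cases "A \<in> M")
    case True
    then have "(\<integral>x. D x * indicator A x \<partial>sm_measure \<Omega> M R) = enn2real (\<integral>\<^sup>+x. ennreal (D x * indicator A x) \<partial>sm_measure \<Omega> M R)"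
      using nn by (intro integral_eq_nn_integral borel_measurable_times borel_measurable_indicator D) auto
    then show ?thesis using True p by (simp add: nnint density_sm_def)
  qed (simp add: density_sm_def sm_outside[OF p(1)])
  then show thesis using that[OF int] by blast
qed

lemma is_sm_pos_part: "is_sm \<Omega> M \<nu> \<Longrightarrow> is_sm \<Omega> M (pos_part M \<nu>)"
  using sm_lincomb[OF is_sm_tv, of \<nu> \<nu> "1/2" "1/2"]
  by (rule back_subst[of "is_sm \<Omega> M"])
    (auto simp: pos_part_def restr_def fun_eq_iff add_divide_distrib sm_outside)

lemma pos_part_nonneg: "is_sm \<Omega> M \<nu> \<Longrightarrow> \<forall>A\<in>M. 0 \<le> pos_part M \<nu> A"
  using abs_le_tv[of \<nu>] by (force simp: pos_part_def restr_def)

text \<open>Absolute continuity is a condition on the total variation, so both Jordan parts inherit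
  it; their densities are subtracted.\<close>

lemma sm_density:
  assumes \<nu>: "is_sm \<Omega> M \<nu>" and R: "is_sm \<Omega> M R" "\<forall>A\<in>M. 0 \<le> R A" and ac: "abs_cont M \<nu> R"
  obtains h where "integrable (sm_measure \<Omega> M R) h" "\<nu> = density_sm (sm_measure \<Omega> M R) h"
proof -
  have \<nu>': "is_sm \<Omega> M (\<lambda>A. - \<nu> A)" using sm_lincomb[OF \<nu> \<nu>, of "-1" 0] by simp
  have null: "pos_part M \<nu> A = 0" "pos_part M (\<lambda>A. - \<nu> A) A = 0" if "A \<in> M" "R A = 0" for A
    using ac that abs_le_tv[OF \<nu>, of A A] by (auto simp: abs_cont_def pos_part_def restr_def)
  obtain h where h: "integrable (sm_measure \<Omega> M R) h" "pos_part M \<nu> = density_sm (sm_measure \<Omega> M R) h"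
    using nonneg_sm_density[OF is_sm_pos_part[OF \<nu>] pos_part_nonneg[OF \<nu>] R null(1)] by blast
  obtain g where g: "integrable (sm_measure \<Omega> M R) g" "pos_part M (\<lambda>A. - \<nu> A) = density_sm (sm_measure \<Omega> M R) g"
    using nonneg_sm_density[OF is_sm_pos_part[OF \<nu>'] pos_part_nonneg[OF \<nu>'] R null(2)] by blast
  show thesis
  proof
    show "integrable (sm_measure \<Omega> M R) (\<lambda>x. 1 * h x + (-1) * g x)" using h g by simp
    show "\<nu> = density_sm (sm_measure \<Omega> M R) (\<lambda>x. 1 * h x + (-1) * g x)"
      unfolding density_sm_lincomb[OF h(1) g(1)] h(2)[symmetric] g(2)[symmetric]
      by (auto simp: fun_eq_iff pos_part_def restr_def sm_outside[OF \<nu>] field_simps)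
  qed
qed

end

section \<open>Integration as a pairing of bounded functions with signed measures\<close>

text \<open>Only the set where |f| exceeds C is tested: there |f| - C is positive, yet its integral
  is at most 0.\<close>

lemma (in finite_measure) AE_abs_le:
  fixes f :: "'a \<Rightarrow> real"
  assumes f: "integrable M f"
    and le: "\<And>A. A \<in> sets M \<Longrightarrow> (\<integral>x. \<bar>f x\<bar> * indicator A x \<partial>M) \<le> C * measure M A"
  shows "AE x in M. \<bar>f x\<bar> \<le> C"
proof -
  have [measurable]: "f \<in> borel_measurable M" using f by simp
  define A where "A = {x\<in>space M. C < \<bar>f x\<bar>}"
  have A [measurable]: "A \<in> sets M" by (simp add: A_def)
  have int: "integrable M (\<lambda>x. \<bar>f x\<bar> * indicator A x)" "integrable M (\<lambda>x. C * indicator A x)"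
    using f A by (auto intro!: integrable_real_mult_indicator simp: emeasure_eq_measure)
  have "(\<integral>x. \<bar>f x\<bar> * indicator A x - C * indicator A x \<partial>M) \<le> 0"
    using le[OF A] int by simp
  moreover have nn: "0 \<le> \<bar>f x\<bar> * indicator A x - C * indicator A x" for x
    by (auto simp: A_def indicator_def)
  ultimately have "(\<integral>x. \<bar>f x\<bar> * indicator A x - C * indicator A x \<partial>M) = 0"
    by (intro antisym Bochner_Integration.integral_nonneg)
  then have "AE x in M. \<bar>f x\<bar> * indicator A x - C * indicator A x = 0"
    using int nn by (subst (asm) integral_nonneg_eq_0_iff_AE) auto
  with AE_space show ?thesis
    by eventually_elim (auto simp: A_def indicator_def split: if_splits)
qed

lemma integrable_bounded_mult:
  fixes f h :: "'a \<Rightarrow> real"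
  assumes [measurable]: "f \<in> borel_measurable N" and h: "integrable N h" and f: "AE x in N. \<bar>f x\<bar> \<le> K"
  shows "integrable N (\<lambda>x. f x * h x)"
proof (rule Bochner_Integration.integrable_bound)
  show "integrable N (\<lambda>x. K * h x)" using h by simp
  show "AE x in N. norm (f x * h x) \<le> norm (K * h x)"
    using f by eventually_elim (auto simp: abs_mult intro!: mult_right_mono)
qed (use h in auto)

lemma qs_mono: "qs \<Omega> G \<R> p \<Longrightarrow> (\<And>\<omega>. \<omega> \<in> \<Omega> \<Longrightarrow> p \<omega> \<Longrightarrow> r \<omega>) \<Longrightarrow> qs \<Omega> G \<R> r"
  unfolding qs_def polar_def by (elim bexE, rule bexI) (auto dest: subsetD)

section \<open>Quasi-sure bounds and the norm of the integration functional\<close>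

locale prob_family = sigma_algebra \<Omega> M for \<Omega> :: "'a set" and M +
  fixes \<R> :: "'a sm set"
  assumes probs: "R \<in> \<R> \<Longrightarrow> is_prob \<Omega> M R"
begin

lemma family_sm: "R \<in> \<R> \<Longrightarrow> is_sm \<Omega> M R" "R \<in> \<R> \<Longrightarrow> \<forall>A\<in>M. 0 \<le> R A"
  using probs unfolding is_prob_def by auto

lemma qs_AE:
  assumes "qs \<Omega> M \<R> p" "R \<in> \<R>"
  shows "AE x in sm_measure \<Omega> M R. p x"
proof -
  obtain N where "N \<in> M" "{\<omega>\<in>\<Omega>. \<not> p \<omega>} \<subseteq> N" "R N = 0"
    using assms by (auto simp: qs_def polar_def)
  then show ?thesis
    using emeasure_sm_measure[OF family_sm[OF assms(2)]] by (intro AE_I[of _ _ N]) auto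
qed

text \<open>Polarity asks for one set that is null for all members. When the property is measurable,
  its exceptional set is such a set, so null sets found separately for each R suffice, however many
  R there are.\<close>

lemma qs_iff_AE:
  assumes "{\<omega>\<in>\<Omega>. p \<omega>} \<in> M"
  shows "qs \<Omega> M \<R> p \<longleftrightarrow> (\<forall>R\<in>\<R>. AE x in sm_measure \<Omega> M R. p x)"
proof
  assume *: "\<forall>R\<in>\<R>. AE x in sm_measure \<Omega> M R. p x"
  have "\<Omega> - {\<omega>\<in>\<Omega>. p \<omega>} \<in> M" using assms by blast
  also have "\<Omega> - {\<omega>\<in>\<Omega>. p \<omega>} = {\<omega>\<in>\<Omega>. \<not> p \<omega>}" by blast
  finally have N: "{\<omega>\<in>\<Omega>. \<not> p \<omega>} \<in> M" .
  have "R {\<omega>\<in>\<Omega>. \<not> p \<omega>} = 0" if R: "R \<in> \<R>" for R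
  proof -
    have "emeasure (sm_measure \<Omega> M R) {\<omega>\<in>\<Omega>. \<not> p \<omega>} = 0"
      using * R N by (subst AE_iff_measurable[symmetric, of _ _ p]) auto
    then show ?thesis
      using N family_sm[OF R] by (simp add: emeasure_sm_measure ennreal_eq_0_iff antisym)
  qed
  then show "qs \<Omega> M \<R> p" unfolding qs_def polar_def using N by blast
qed (simp add: qs_AE)

lemma sets_meas_space: "sets (meas_space \<Omega> M) = M" "space (meas_space \<Omega> M) = \<Omega>"
  by (simp_all add: meas_space_def space_closed)

lemma borel_measurable_sm_measure: "borel_measurable (sm_measure \<Omega> M R) = borel_measurable (meas_space \<Omega> M)"
  by (rule measurable_cong_sets) (simp_all add: sets_meas_space)

lemma Linf_borel: "f \<in> Linf \<Omega> M \<R> \<Longrightarrow> f \<in> borel_measurable (sm_measure \<Omega> M R)"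
  by (simp add: Linf_def borel_measurable_sm_measure)

lemma qs_abs_le_iff:
  fixes f :: "'a \<Rightarrow> real"
  assumes "f \<in> borel_measurable (meas_space \<Omega> M)"
  shows "qs \<Omega> M \<R> (\<lambda>\<omega>. \<bar>f \<omega>\<bar> \<le> K) \<longleftrightarrow> (\<forall>R\<in>\<R>. AE x in sm_measure \<Omega> M R. \<bar>f x\<bar> \<le> K)"
proof (rule qs_iff_AE)
  note [measurable] = assms
  have "{\<omega>\<in>space (meas_space \<Omega> M). \<bar>f \<omega>\<bar> \<le> K} \<in> sets (meas_space \<Omega> M)"
    by measurable
  then show "{\<omega>\<in>\<Omega>. \<bar>f \<omega>\<bar> \<le> K} \<in> M" by (simp add: sets_meas_space)
qed

lemma Linf_lincomb:
  assumes "f \<in> Linf \<Omega> M \<R>" "g \<in> Linf \<Omega> M \<R>"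
  shows "(\<lambda>\<omega>. a * f \<omega> + b * g \<omega>) \<in> Linf \<Omega> M \<R>"
proof -
  have [measurable]: "f \<in> borel_measurable (meas_space \<Omega> M)" "g \<in> borel_measurable (meas_space \<Omega> M)"
    using assms by (auto simp: Linf_def)
  obtain K L where KL: "qs \<Omega> M \<R> (\<lambda>\<omega>. \<bar>f \<omega>\<bar> \<le> K)" "qs \<Omega> M \<R> (\<lambda>\<omega>. \<bar>g \<omega>\<bar> \<le> L)"
    using assms by (auto simp: Linf_def)
  have meas: "(\<lambda>\<omega>. a * f \<omega> + b * g \<omega>) \<in> borel_measurable (meas_space \<Omega> M)" by measurable
  have "AE x in sm_measure \<Omega> M R. \<bar>a * f x + b * g x\<bar> \<le> \<bar>a\<bar> * K + \<bar>b\<bar> * L" if "R \<in> \<R>" for R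
    using KL[THEN qs_AE[OF _ that]]
  proof eventually_elim
    case (elim x)
    have "\<bar>a * f x + b * g x\<bar> \<le> \<bar>a\<bar> * \<bar>f x\<bar> + \<bar>b\<bar> * \<bar>g x\<bar>"
      by (metis abs_mult abs_triangle_ineq)
    also have "\<dots> \<le> \<bar>a\<bar> * K + \<bar>b\<bar> * L" using elim by (intro add_mono mult_left_mono) auto
    finally show ?case .
  qed
  then show ?thesis using meas qs_abs_le_iff[OF meas] unfolding Linf_def by auto
qed

lemma ca_density:
  assumes "\<nu> \<in> ca \<Omega> M \<R>"
  obtains R h where "R \<in> \<R>" "integrable (sm_measure \<Omega> M R) h" "\<nu> = density_sm (sm_measure \<Omega> M R) h"
proof -
  obtain R where R: "R \<in> \<R>" "abs_cont M \<nu> R" and \<nu>: "is_sm \<Omega> M \<nu>"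
    using assms by (auto simp: ca_def)
  show ?thesis
    using sm_density[OF \<nu> family_sm[OF R(1)] R(2)] that[OF R(1)] by blast
qed

lemma density_sm_abs_cont:
  assumes R: "is_sm \<Omega> M R" "\<forall>A\<in>M. 0 \<le> R A" and h: "integrable (sm_measure \<Omega> M R) h" and A: "A \<in> M" "R A = 0"
  shows "density_sm (sm_measure \<Omega> M R) h A = 0"
proof -
  have "AE x in sm_measure \<Omega> M R. x \<notin> A"
    using A emeasure_sm_measure[OF R] by (intro AE_not_in) (auto simp: null_sets_def)
  then have "AE x in sm_measure \<Omega> M R. h x * indicator A x = 0" by eventually_elim simp
  then show ?thesis unfolding density_sm_def by (simp add: integral_eq_zero_AE)
qed

lemma is_sm_density_sm_sm_measure: "integrable (sm_measure \<Omega> M R) h \<Longrightarrow> is_sm \<Omega> M (density_sm (sm_measure \<Omega> M R) h)"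
  using is_sm_density_sm[of "sm_measure \<Omega> M R" h \<Omega>] by simp

lemma density_sm_in_ca:
  assumes R: "R \<in> \<R>" and h: "integrable (sm_measure \<Omega> M R) h"
  shows "density_sm (sm_measure \<Omega> M R) h \<in> ca \<Omega> M \<R>"
  unfolding ca_def
  using R density_sm_abs_cont[OF family_sm[OF R] h] abs_cont_iff[OF is_sm_density_sm_sm_measure[OF h] family_sm[OF R]] is_sm_density_sm_sm_measure[OF h]
  by auto

lemma tvnorm_density_sm_sm_measure:
  "integrable (sm_measure \<Omega> M R) h \<Longrightarrow> tvnorm \<Omega> M (density_sm (sm_measure \<Omega> M R) h) = (\<integral>x. \<bar>h x\<bar> \<partial>sm_measure \<Omega> M R)"
  using tvnorm_density_sm[of "sm_measure \<Omega> M R" h] by simp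

lemma sm_integral_density:
  assumes f: "f \<in> Linf \<Omega> M \<R>" and R: "R \<in> \<R>" and h: "integrable (sm_measure \<Omega> M R) h"
  shows "integrable (sm_measure \<Omega> M R) (\<lambda>x. f x * h x)"
    and "sm_integral \<Omega> M f (density_sm (sm_measure \<Omega> M R) h) = (\<integral>x. f x * h x \<partial>sm_measure \<Omega> M R)"
proof -
  obtain K where "qs \<Omega> M \<R> (\<lambda>\<omega>. \<bar>f \<omega>\<bar> \<le> K)" using f by (auto simp: Linf_def)
  then show *: "integrable (sm_measure \<Omega> M R) (\<lambda>x. f x * h x)"
    using Linf_borel[OF f] h qs_AE[OF _ R] by (intro integrable_bounded_mult) auto
  show "sm_integral \<Omega> M f (density_sm (sm_measure \<Omega> M R) h) = (\<integral>x. f x * h x \<partial>sm_measure \<Omega> M R)"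
    using sm_integral_density_sm[OF Linf_borel[OF f] h *] by simp
qed

lemma abs_sm_integral_le:
  assumes f: "f \<in> Linf \<Omega> M \<R>" and K: "qs \<Omega> M \<R> (\<lambda>\<omega>. \<bar>f \<omega>\<bar> \<le> K)" and \<nu>: "\<nu> \<in> ca \<Omega> M \<R>"
  shows "\<bar>sm_integral \<Omega> M f \<nu>\<bar> \<le> K * tvnorm \<Omega> M \<nu>"
proof -
  obtain R h where R: "R \<in> \<R>" and h: "integrable (sm_measure \<Omega> M R) h" and \<nu>h: "\<nu> = density_sm (sm_measure \<Omega> M R) h"
    using \<nu> by (rule ca_density)
  have "\<bar>\<integral>x. f x * h x \<partial>sm_measure \<Omega> M R\<bar> \<le> (\<integral>x. \<bar>f x * h x\<bar> \<partial>sm_measure \<Omega> M R)" by (rule integral_abs_bound)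
  also have "\<dots> \<le> (\<integral>x. K * \<bar>h x\<bar> \<partial>sm_measure \<Omega> M R)"
  proof (rule integral_mono_AE)
    show "AE x in sm_measure \<Omega> M R. \<bar>f x * h x\<bar> \<le> K * \<bar>h x\<bar>"
      using qs_AE[OF K R] by eventually_elim (simp add: abs_mult mult_right_mono)
  qed (use integrable_abs[OF sm_integral_density(1)[OF f R h]] h in auto)
  finally show ?thesis unfolding \<nu>h sm_integral_density(2)[OF f R h] tvnorm_density_sm_sm_measure[OF h] by simp
qed

lemma sm_integral_lincomb_fun:
  assumes f: "f \<in> Linf \<Omega> M \<R>" and g: "g \<in> Linf \<Omega> M \<R>" and \<nu>: "\<nu> \<in> ca \<Omega> M \<R>"
  shows "sm_integral \<Omega> M (\<lambda>\<omega>. a * f \<omega> + b * g \<omega>) \<nu> = a * sm_integral \<Omega> M f \<nu> + b * sm_integral \<Omega> M g \<nu>"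
proof -
  obtain R h where R: "R \<in> \<R>" and h: "integrable (sm_measure \<Omega> M R) h" and \<nu>h: "\<nu> = density_sm (sm_measure \<Omega> M R) h"
    using \<nu> by (rule ca_density)
  show ?thesis
    unfolding \<nu>h sm_integral_density(2)[OF f R h] sm_integral_density(2)[OF g R h] sm_integral_density(2)[OF Linf_lincomb[OF f g] R h]
    using sm_integral_density(1)[OF f R h] sm_integral_density(1)[OF g R h]
    by (simp add: distrib_right mult.assoc)
qed

text \<open>The converse of \<open>abs_sm_integral_le\<close>: test against the measures with density \<open>sgn f\<close> on a set.\<close>

lemma qs_abs_le_of_sm_integral:
  assumes f: "f \<in> Linf \<Omega> M \<R>" and C: "0 \<le> C" and le: "\<And>\<nu>. \<nu> \<in> ca \<Omega> M \<R> \<Longrightarrow> \<bar>sm_integral \<Omega> M f \<nu>\<bar> \<le> C * tvnorm \<Omega> M \<nu>"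
  shows "qs \<Omega> M \<R> (\<lambda>\<omega>. \<bar>f \<omega>\<bar> \<le> C)"
proof -
  have "AE x in sm_measure \<Omega> M R. \<bar>f x\<bar> \<le> C" if R: "R \<in> \<R>" for R
  proof -
    interpret R: finite_measure "sm_measure \<Omega> M R" by (rule finite_measure_sm_measure[OF family_sm[OF R]])
    note [measurable] = Linf_borel[OF f, of R]
    have one: "integrable (sm_measure \<Omega> M R) (\<lambda>_. 1::real)" by simp
    show ?thesis
    proof (rule R.AE_abs_le)
      show "integrable (sm_measure \<Omega> M R) f" using sm_integral_density(1)[OF f R one] by simp
      fix A assume A: "A \<in> sets (sm_measure \<Omega> M R)"
      let ?h = "\<lambda>x. sgn (f x) * indicator A x :: real"
      have hm: "?h \<in> borel_measurable (sm_measure \<Omega> M R)" 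
        using A by (intro borel_measurable_times borel_measurable_indicator) measurable
      have h: "integrable (sm_measure \<Omega> M R) ?h"
        using hm by (intro R.integrable_const_bound[of _ 1]) (auto simp: indicator_def sgn_if)
      have "(\<integral>x. \<bar>f x\<bar> * indicator A x \<partial>sm_measure \<Omega> M R) = (\<integral>x. f x * ?h x \<partial>sm_measure \<Omega> M R)"
        by (intro Bochner_Integration.integral_cong) (auto simp: abs_sgn mult.assoc)
      also have "\<dots> \<le> C * tvnorm \<Omega> M (density_sm (sm_measure \<Omega> M R) ?h)"
        using le[OF density_sm_in_ca[OF R h]] unfolding sm_integral_density(2)[OF f R h] by simp
      also have "\<dots> \<le> C * (\<integral>x. indicator A x \<partial>sm_measure \<Omega> M R)"
        unfolding tvnorm_density_sm_sm_measure[OF h]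
      proof (intro mult_left_mono[OF _ C] integral_mono)
        show "integrable (sm_measure \<Omega> M R) (indicator A :: 'a \<Rightarrow> real)"
          using A by (simp add: R.emeasure_eq_measure)
      qed (use h in \<open>auto simp: indicator_def sgn_if\<close>)
      also have "(\<integral>x. indicator A x \<partial>sm_measure \<Omega> M R) = measure (sm_measure \<Omega> M R) A" using A by simp
      finally show "(\<integral>x. \<bar>f x\<bar> * indicator A x \<partial>sm_measure \<Omega> M R) \<le> C * measure (sm_measure \<Omega> M R) A" .
    qed
  qed
  then show ?thesis using f by (subst qs_abs_le_iff) (auto simp: Linf_def)
qed

text \<open>Injectivity modulo quasi-sure equality is the case of the bound 0 in the two norm
  estimates, applied to f - g.\<close>

lemma sm_integral_eq_iff:
  assumes f: "f \<in> Linf \<Omega> M \<R>" and g: "g \<in> Linf \<Omega> M \<R>"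
  shows "(\<forall>\<nu>\<in>ca \<Omega> M \<R>. sm_integral \<Omega> M f \<nu> = sm_integral \<Omega> M g \<nu>) \<longleftrightarrow> qs \<Omega> M \<R> (\<lambda>\<omega>. f \<omega> = g \<omega>)"
proof -
  let ?d = "\<lambda>\<omega>. 1 * f \<omega> + (-1) * g \<omega>"
  note d = Linf_lincomb[OF f g, of 1 "-1"] and sd = sm_integral_lincomb_fun[OF f g, of _ 1 "-1"]
  have "qs \<Omega> M \<R> (\<lambda>\<omega>. f \<omega> = g \<omega>) \<longleftrightarrow> qs \<Omega> M \<R> (\<lambda>\<omega>. \<bar>?d \<omega>\<bar> \<le> 0)" by (simp add: eq_iff)
  moreover have "\<forall>\<nu>\<in>ca \<Omega> M \<R>. sm_integral \<Omega> M f \<nu> = sm_integral \<Omega> M g \<nu>" if "qs \<Omega> M \<R> (\<lambda>\<omega>. \<bar>?d \<omega>\<bar> \<le> 0)"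
    using abs_sm_integral_le[OF d that] sd by auto
  moreover have "qs \<Omega> M \<R> (\<lambda>\<omega>. \<bar>?d \<omega>\<bar> \<le> 0)" if "\<forall>\<nu>\<in>ca \<Omega> M \<R>. sm_integral \<Omega> M f \<nu> = sm_integral \<Omega> M g \<nu>"
    using that sd by (intro qs_abs_le_of_sm_integral[OF d]) auto
  ultimately show ?thesis by blast
qed

lemma opnorm_sm_integral:
  assumes f: "f \<in> Linf \<Omega> M \<R>"
  shows "opnorm \<Omega> M \<R> (sm_integral \<Omega> M f) = linf_norm \<Omega> M \<R> f"
  unfolding opnorm_def linf_norm_def
proof (rule antisym)
  let ?C = "{C. 0 \<le> C \<and> (\<forall>\<nu>\<in>ca \<Omega> M \<R>. \<bar>sm_integral \<Omega> M f \<nu>\<bar> \<le> C * tvnorm \<Omega> M \<nu>)}"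
  let ?K = "{K. 0 < K \<and> qs \<Omega> M \<R> (\<lambda>\<omega>. \<bar>f \<omega>\<bar> \<le> K)}"
  obtain K where K: "qs \<Omega> M \<R> (\<lambda>\<omega>. \<bar>f \<omega>\<bar> \<le> K)" using f by (auto simp: Linf_def)
  \<comment> \<open>The bound supplied by \<open>Linf\<close> need not be positive, whereas the
    infimum runs over positive bounds.\<close>
  have "qs \<Omega> M \<R> (\<lambda>\<omega>. \<bar>f \<omega>\<bar> \<le> max K 1)" by (rule qs_mono[OF K]) auto
  then have ne: "max K 1 \<in> ?K" by auto
  have sub: "?K \<subseteq> ?C" using abs_sm_integral_le[OF f] by auto
  show "Inf ?C \<le> Inf ?K"
    using ne sub by (intro cInf_superset_mono) (auto simp: bdd_below_def)
  show "Inf ?K \<le> Inf ?C"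
  proof (rule cInf_greatest)
    show "?C \<noteq> {}" using ne sub by blast
    fix C assume "C \<in> ?C"
    then have C: "0 \<le> C" "qs \<Omega> M \<R> (\<lambda>\<omega>. \<bar>f \<omega>\<bar> \<le> C)"
      using qs_abs_le_of_sm_integral[OF f, of C] by auto
    show "Inf ?K \<le> C"
    \<comment> \<open>C may be 0, which the strict positivity in \<open>linf_norm\<close> excludes;
      C is therefore reached only as a limit of C + e.\<close>
    proof (rule field_le_epsilon)
      fix e :: real assume "0 < e"
      have "qs \<Omega> M \<R> (\<lambda>\<omega>. \<bar>f \<omega>\<bar> \<le> C + e)" by (rule qs_mono[OF C(2)]) (use \<open>0 < e\<close> in auto)
      then show "Inf ?K \<le> C + e" using C(1) \<open>0 < e\<close>
        by (intro cInf_lower) (auto simp: bdd_below_def intro!: exI[of _ 0])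
    qed
  qed
qed

end

section \<open>Linearity in the measure\<close>

locale convex_prob_family = prob_family +
  assumes convex: "convex_family \<R>"
begin

lemma ca_common_density:
  assumes \<mu>: "\<mu> \<in> ca \<Omega> M \<R>" and \<nu>: "\<nu> \<in> ca \<Omega> M \<R>"
  obtains R h g where "R \<in> \<R>" "integrable (sm_measure \<Omega> M R) h" "\<mu> = density_sm (sm_measure \<Omega> M R) h"
    "integrable (sm_measure \<Omega> M R) g" "\<nu> = density_sm (sm_measure \<Omega> M R) g"
proof -
  obtain P where P: "P \<in> \<R>" "abs_cont M \<mu> P" using \<mu> by (auto simp: ca_def)
  obtain Q where Q: "Q \<in> \<R>" "abs_cont M \<nu> Q" using \<nu> by (auto simp: ca_def)
  have sm: "is_sm \<Omega> M \<mu>" "is_sm \<Omega> M \<nu>" using assms by (auto simp: ca_def)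
  \<comment> \<open>The midpoint: a null set of the sum is null for P and for Q because both terms
    are nonnegative.\<close>
  define R where "R = (\<lambda>A. 1/2 * P A + (1 - 1/2) * Q A)"
  have "\<forall>t::real. 0 \<le> t \<and> t \<le> 1 \<longrightarrow> (\<lambda>A. t * P A + (1 - t) * Q A) \<in> \<R>"
    using convex P(1) Q(1) unfolding convex_family_def by blast
  from this[rule_format, of "1/2"] have R: "R \<in> \<R>" by (simp add: R_def)
  have "P A = 0 \<and> Q A = 0" if "A \<in> M" "R A = 0" for A
  proof -
    have "0 \<le> P A" "0 \<le> Q A" using family_sm(2)[OF P(1)] family_sm(2)[OF Q(1)] that(1) by auto
    then show ?thesis using that(2) by (simp add: R_def)
  qed
  then have "abs_cont M \<mu> R" "abs_cont M \<nu> R"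
    using P(2) Q(2) by (auto simp: abs_cont_def)
  then show ?thesis
    using sm_density[OF sm(1) family_sm[OF R]] sm_density[OF sm(2) family_sm[OF R]] that[OF R] by metis
qed

lemma ca_lincomb:
  assumes "\<mu> \<in> ca \<Omega> M \<R>" "\<nu> \<in> ca \<Omega> M \<R>"
  shows "(\<lambda>A. a * \<mu> A + b * \<nu> A) \<in> ca \<Omega> M \<R>"
proof -
  obtain R h g where R: "R \<in> \<R>" and hg: "integrable (sm_measure \<Omega> M R) h" "\<mu> = density_sm (sm_measure \<Omega> M R) h"
    "integrable (sm_measure \<Omega> M R) g" "\<nu> = density_sm (sm_measure \<Omega> M R) g"
    using assms by (rule ca_common_density)
  show ?thesis
    unfolding hg(2,4) density_sm_lincomb[OF hg(1,3), symmetric]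
    using hg by (intro density_sm_in_ca[OF R]) auto
qed

lemma blf_sm_integral:
  assumes f: "f \<in> Linf \<Omega> M \<R>"
  shows "blf \<Omega> M \<R> (sm_integral \<Omega> M f)"
  unfolding blf_def
proof (intro conjI ballI allI)
  fix \<mu> \<nu> a b assume "\<mu> \<in> ca \<Omega> M \<R>" "\<nu> \<in> ca \<Omega> M \<R>"
  then obtain R h g where R: "R \<in> \<R>" and h: "integrable (sm_measure \<Omega> M R) h" "\<mu> = density_sm (sm_measure \<Omega> M R) h"
    and g: "integrable (sm_measure \<Omega> M R) g" "\<nu> = density_sm (sm_measure \<Omega> M R) g"
    by (rule ca_common_density)
  have hg: "integrable (sm_measure \<Omega> M R) (\<lambda>x. a * h x + b * g x)" using h g by simp
  show "sm_integral \<Omega> M f (\<lambda>A. a * \<mu> A + b * \<nu> A) = a * sm_integral \<Omega> M f \<mu> + b * sm_integral \<Omega> M f \<nu>"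
    unfolding h(2) g(2) density_sm_lincomb[OF h(1) g(1), symmetric] sm_integral_density(2)[OF f R hg]
      sm_integral_density(2)[OF f R h(1)] sm_integral_density(2)[OF f R g(1)]
    using sm_integral_density(1)[OF f R h(1)] sm_integral_density(1)[OF f R g(1)]
    by (simp add: distrib_left mult.left_commute)
next
  show "\<exists>C. \<forall>\<mu>\<in>ca \<Omega> M \<R>. \<bar>sm_integral \<Omega> M f \<mu>\<bar> \<le> C * tvnorm \<Omega> M \<mu>"
    using f abs_sm_integral_le[OF f] by (auto simp: Linf_def)
qed

end

section \<open>Representing bounded linear functionals on a localized family\<close>

definition restrict_sm :: "'a set set \<Rightarrow> 'a sm \<Rightarrow> 'a set \<Rightarrow> 'a sm" where
  "restrict_sm G \<nu> A = restr G (\<lambda>B. \<nu> (B \<inter> A))"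

section \<open>Restriction of a measure to a set\<close>

context sigma_algebra
begin

text \<open>Domination upgrades finite to countable additivity: the error after n terms is the value
  of \<kappa> on the remaining tail, and the m-measure of the tails tends to 0. This turns
  continuity of a functional into countable additivity.\<close>

lemma is_sm_dominated:
  assumes m: "is_sm \<Omega> M m" and out: "\<And>A. A \<notin> M \<Longrightarrow> \<kappa> A = 0"
    and add: "\<And>A B. A \<in> M \<Longrightarrow> B \<in> M \<Longrightarrow> A \<inter> B = {} \<Longrightarrow> \<kappa> (A \<union> B) = \<kappa> A + \<kappa> B"
    and le: "\<And>A. A \<in> M \<Longrightarrow> \<bar>\<kappa> A\<bar> \<le> C * m A"
  shows "is_sm \<Omega> M \<kappa>"
proof (rule is_smI[OF out])
  fix A :: "nat \<Rightarrow> 'a set" assume A: "range A \<subseteq> M" "disjoint_family A"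
  let ?U = "\<Union>i. A i" and ?D = "\<lambda>n. \<Union>i<n. A i"
  have Ai: "A i \<in> M" for i using A by auto
  have U: "?U \<in> M" using A by blast
  have D: "?D n \<in> M" for n using Ai by auto
  have "\<kappa> {} = 0" using add[of "{}" "{}"] by auto
  have "\<kappa> (?D n) = (\<Sum>i<n. \<kappa> (A i)) \<and> m (?D n) = (\<Sum>i<n. m (A i))" for n
  proof (induction n)
    case (Suc n)
    have disj: "?D n \<inter> A n = {}"
      using A(2) by (auto simp: disjoint_family_on_def) (metis IntI emptyE less_irrefl)
    have "?D (Suc n) = ?D n \<union> A n" by (auto simp: less_Suc_eq)
    then show ?case using add[OF D Ai disj] sm_Un[OF m D Ai disj] Suc by simp
  qed (use sm_empty[OF m] \<open>\<kappa> {} = 0\<close> in auto)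
  then have Dsum: "\<kappa> (?D n) = (\<Sum>i<n. \<kappa> (A i))" "m (?D n) = (\<Sum>i<n. m (A i))" for n by blast+
  have bound: "norm ((\<Sum>i<n. \<kappa> (A i)) - \<kappa> ?U) \<le> C * (m ?U - (\<Sum>i<n. m (A i)))" for n
  proof -
    have "\<kappa> (?D n \<union> (?U - ?D n)) = \<kappa> (?D n) + \<kappa> (?U - ?D n)"
      using D U by (intro add) auto
    moreover have "?D n \<union> (?U - ?D n) = ?U" by auto
    ultimately have "norm ((\<Sum>i<n. \<kappa> (A i)) - \<kappa> ?U) = \<bar>\<kappa> (?U - ?D n)\<bar>" by (simp add: Dsum)
    also have "\<dots> \<le> C * m (?U - ?D n)" using D U by (intro le) auto
    also have "m (?U - ?D n) = m ?U - m (?D n)" using D U by (intro sm_Diff[OF m]) auto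
    finally show ?thesis by (simp add: Dsum)
  qed
  have "(\<lambda>n. \<Sum>i<n. m (A i)) \<longlonglongrightarrow> m ?U" using sm_sums[OF m A] by (simp add: sums_def)
  then have "(\<lambda>n. C * (m ?U - (\<Sum>i<n. m (A i)))) \<longlonglongrightarrow> C * (m ?U - m ?U)" by (intro tendsto_intros)
  then have lim0: "(\<lambda>n. C * (m ?U - (\<Sum>i<n. m (A i)))) \<longlonglongrightarrow> 0" by simp
  have "(\<lambda>n. (\<Sum>i<n. \<kappa> (A i)) - \<kappa> ?U) \<longlonglongrightarrow> 0"
    by (rule Lim_null_comparison[OF always_eventually lim0]) (use bound in blast)
  then show "(\<lambda>i. \<kappa> (A i)) sums \<kappa> ?U"
    unfolding sums_def by (simp add: LIM_zero_iff)
qed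

lemma tv_nonneg_sm:
  assumes R: "is_sm \<Omega> M R" "\<forall>A\<in>M. 0 \<le> R A" and A: "A \<in> M"
  shows "tv M R A = R A"
proof (rule antisym)
  show "tv M R A \<le> R A"
  proof (rule tv_le)
    fix D assume D: "finite D" "D \<subseteq> M" "disjoint D" "\<Union>D \<subseteq> A"
    have "(\<Sum>B\<in>D. \<bar>R B\<bar>) = (\<Sum>B\<in>D. R B)" using R(2) D by (intro sum.cong) auto
    also have "\<dots> = R (\<Union>D)" by (rule sm_Union[OF R(1) D(1-3), symmetric])
    also have "\<dots> \<le> R A" using D A by (intro sm_mono[OF R]) auto
    finally show "(\<Sum>B\<in>D. \<bar>R B\<bar>) \<le> R A" .
  qed
  show "R A \<le> tv M R A" using abs_le_tv[OF R(1) A, of A] by simp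
qed

lemma is_sm_restrict_sm:
  assumes \<nu>: "is_sm \<Omega> M \<nu>" and A: "A \<in> M"
  shows "is_sm \<Omega> M (restrict_sm M \<nu> A)"
proof (rule is_smI)
  fix B :: "nat \<Rightarrow> 'a set" assume B: "range B \<subseteq> M" "disjoint_family B"
  have "range (\<lambda>i. B i \<inter> A) \<subseteq> M" "disjoint_family (\<lambda>i. B i \<inter> A)"
    using A B by (auto simp: disjoint_family_on_def)
  from sm_sums[OF \<nu> this] have "(\<lambda>i. \<nu> (B i \<inter> A)) sums \<nu> ((\<Union>i. B i) \<inter> A)" by simp
  moreover have "B i \<in> M" "(\<Union>i. B i) \<in> M" for i using B by auto
  ultimately show "(\<lambda>i. restrict_sm M \<nu> A (B i)) sums restrict_sm M \<nu> A (\<Union>i. B i)"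
    by (simp add: restrict_sm_def restr_def)
qed (simp add: restrict_sm_def restr_def)

lemma restrict_sm_Un:
  assumes \<nu>: "is_sm \<Omega> M \<nu>" and "A \<in> M" "B \<in> M" "A \<inter> B = {}"
  shows "restrict_sm M \<nu> (A \<union> B) = (\<lambda>C. 1 * restrict_sm M \<nu> A C + 1 * restrict_sm M \<nu> B C)"
proof
  fix C
  show "restrict_sm M \<nu> (A \<union> B) C = 1 * restrict_sm M \<nu> A C + 1 * restrict_sm M \<nu> B C"
  proof (cases "C \<in> M")
    case True
    then have "\<nu> ((C \<inter> A) \<union> (C \<inter> B)) = \<nu> (C \<inter> A) + \<nu> (C \<inter> B)"
      using assms by (intro sm_Un[OF \<nu>]) auto
    then show ?thesis using True by (simp add: restrict_sm_def restr_def Int_Un_distrib)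
  qed (simp add: restrict_sm_def restr_def)
qed

lemma restrict_sm_space: "is_sm \<Omega> M \<nu> \<Longrightarrow> restrict_sm M \<nu> \<Omega> = \<nu>"
  by (auto simp: restrict_sm_def restr_def fun_eq_iff sm_outside Int_absorb2 sets_into_space)

lemma tvnorm_restrict_sm_le:
  assumes \<nu>: "is_sm \<Omega> M \<nu>" and A: "A \<in> M"
  shows "tvnorm \<Omega> M (restrict_sm M \<nu> A) \<le> tv M \<nu> A"
  unfolding tvnorm_def
proof (rule tv_le)
  fix D assume D: "finite D" "D \<subseteq> M" "disjoint D" "\<Union>D \<subseteq> \<Omega>"
  have "(\<Sum>B\<in>D. \<bar>restrict_sm M \<nu> A B\<bar>) = (\<Sum>B\<in>D. \<bar>\<nu> (B \<inter> A)\<bar>)"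
    using D by (intro sum.cong) (auto simp: restrict_sm_def restr_def)
  also have "\<dots> \<le> tv M \<nu> A"
    unfolding tv_eq_Sup using D A
    by (intro cSup_upper varsums_Int_image[OF \<nu>] bdd_varsums[OF \<nu>]) auto
  finally show "(\<Sum>B\<in>D. \<bar>restrict_sm M \<nu> A B\<bar>) \<le> tv M \<nu> A" .
qed

end

section \<open>Functionals on the measures dominated by one measure\<close>

context prob_family
begin

lemma restrict_sm_in_ca:
  assumes \<nu>: "\<nu> \<in> ca \<Omega> M \<R>" and A: "A \<in> M"
  shows "restrict_sm M \<nu> A \<in> ca \<Omega> M \<R>"
proof -
  obtain R where R: "R \<in> \<R>" "abs_cont M \<nu> R" using \<nu> by (auto simp: ca_def)
  have sm: "is_sm \<Omega> M \<nu>" using \<nu> by (auto simp: ca_def)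
  have "restrict_sm M \<nu> A B = 0" if "B \<in> M" "R B = 0" for B
  proof -
    have "tv M \<nu> B = 0" "B \<inter> A \<in> M" using R(2) that A by (auto simp: abs_cont_def)
    then show ?thesis using abs_le_tv[OF sm, of "B \<inter> A" B] that by (simp add: restrict_sm_def restr_def)
  qed
  then have "abs_cont M (restrict_sm M \<nu> A) R"
    using abs_cont_iff[OF is_sm_restrict_sm[OF sm A] family_sm[OF R(1)]] by blast
  then show ?thesis using R(1) is_sm_restrict_sm[OF sm A] by (auto simp: ca_def)
qed

lemma blf_lincomb:
  "blf \<Omega> M \<R> \<phi> \<Longrightarrow> \<mu> \<in> ca \<Omega> M \<R> \<Longrightarrow> \<nu> \<in> ca \<Omega> M \<R> \<Longrightarrow>
    \<phi> (\<lambda>A. a * \<mu> A + b * \<nu> A) = a * \<phi> \<mu> + b * \<phi> \<nu>"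
  unfolding blf_def by blast

lemma blf_bound:
  assumes "blf \<Omega> M \<R> \<phi>"
  obtains C where "0 \<le> C" "\<And>\<mu>. \<mu> \<in> ca \<Omega> M \<R> \<Longrightarrow> \<bar>\<phi> \<mu>\<bar> \<le> C * tvnorm \<Omega> M \<mu>"
proof -
  obtain C where C: "\<forall>\<mu>\<in>ca \<Omega> M \<R>. \<bar>\<phi> \<mu>\<bar> \<le> C * tvnorm \<Omega> M \<mu>"
    using assms unfolding blf_def by blast
  have "\<bar>\<phi> \<mu>\<bar> \<le> \<bar>C\<bar> * tvnorm \<Omega> M \<mu>" if \<mu>: "\<mu> \<in> ca \<Omega> M \<R>" for \<mu>
  proof -
    have "0 \<le> tvnorm \<Omega> M \<mu>" using \<mu> by (auto simp: ca_def tvnorm_def intro: tv_nonneg)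
    then have "C * tvnorm \<Omega> M \<mu> \<le> \<bar>C\<bar> * tvnorm \<Omega> M \<mu>" by (intro mult_right_mono) auto
    then show ?thesis using C \<mu> by force
  qed
  then show ?thesis using that[of "\<bar>C\<bar>"] by simp
qed

text \<open>Linearity of \<phi> gives finite additivity, and its bound gives domination by C times
  the total variation of \<nu>.\<close>

lemma blf_restrict_sm:
  assumes \<phi>: "blf \<Omega> M \<R> \<phi>" and \<nu>: "\<nu> \<in> ca \<Omega> M \<R>"
  shows "is_sm \<Omega> M (restr M (\<lambda>A. \<phi> (restrict_sm M \<nu> A)))"
proof -
  have sm: "is_sm \<Omega> M \<nu>" using \<nu> by (auto simp: ca_def)
  obtain C where C: "0 \<le> C" "\<And>\<mu>. \<mu> \<in> ca \<Omega> M \<R> \<Longrightarrow> \<bar>\<phi> \<mu>\<bar> \<le> C * tvnorm \<Omega> M \<mu>"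
    using blf_bound[OF \<phi>] by blast
  show ?thesis
  proof (rule is_sm_dominated[OF is_sm_tv[OF sm]])
    fix A B assume "A \<in> M" "B \<in> M" "A \<inter> B = {}"
    then show "restr M (\<lambda>A. \<phi> (restrict_sm M \<nu> A)) (A \<union> B) = restr M (\<lambda>A. \<phi> (restrict_sm M \<nu> A)) A + restr M (\<lambda>A. \<phi> (restrict_sm M \<nu> A)) B"
      using blf_lincomb[OF \<phi> restrict_sm_in_ca[OF \<nu>] restrict_sm_in_ca[OF \<nu>], of A B 1 1]
      by (simp add: restr_def restrict_sm_Un[OF sm] Un)
  next
    fix A assume A: "A \<in> M"
    have "\<bar>\<phi> (restrict_sm M \<nu> A)\<bar> \<le> C * tvnorm \<Omega> M (restrict_sm M \<nu> A)" by (rule C(2)[OF restrict_sm_in_ca[OF \<nu> A]])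
    also have "\<dots> \<le> C * tv M \<nu> A" by (rule mult_left_mono[OF tvnorm_restrict_sm_le[OF sm A] C(1)])
    finally show "\<bar>restr M (\<lambda>A. \<phi> (restrict_sm M \<nu> A)) A\<bar> \<le> C * restr M (tv M \<nu>) A"
      using A by (simp add: restr_def)
  qed (simp add: restr_def)
qed

text \<open>The representing function is the density of \<open>A \<mapsto> \<phi> (q restricted to A)\<close>.\<close>

lemma blf_density:
  assumes \<phi>: "blf \<Omega> M \<R> \<phi>" and q: "q \<in> ca \<Omega> M \<R>" "\<forall>A\<in>M. 0 \<le> q A"
    and C: "0 \<le> C" "\<And>\<mu>. \<mu> \<in> ca \<Omega> M \<R> \<Longrightarrow> \<bar>\<phi> \<mu>\<bar> \<le> C * tvnorm \<Omega> M \<mu>"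
  obtains f where "f \<in> borel_measurable (sm_measure \<Omega> M q)" "\<And>x. \<bar>f x\<bar> \<le> C"
    "\<And>h. integrable (sm_measure \<Omega> M q) h \<Longrightarrow> \<phi> (density_sm (sm_measure \<Omega> M q) h) = (\<integral>x. f x * h x \<partial>sm_measure \<Omega> M q)"
proof -
  let ?N = "sm_measure \<Omega> M q"
  have sm: "is_sm \<Omega> M q" using q by (auto simp: ca_def)
  interpret N: finite_measure ?N by (rule finite_measure_sm_measure[OF sm q(2)])
  obtain R where R: "R \<in> \<R>" "abs_cont M q R" using q by (auto simp: ca_def)
  \<comment> \<open>q itself need not belong to \<R>. A measure with a density with respect to q is
    still dominated by the member R that dominates q.\<close>
  have ca: "density_sm ?N h \<in> ca \<Omega> M \<R>" if h: "integrable ?N h" for h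
  proof -
    have "density_sm ?N h A = 0" if "A \<in> M" "R A = 0" for A
      using density_sm_abs_cont[OF sm q(2) h that(1)] R(2) that by (auto simp: abs_cont_def tv_eq_0_iff[OF sm])
    then show ?thesis
      using abs_cont_iff[OF is_sm_density_sm_sm_measure[OF h] family_sm[OF R(1)]] is_sm_density_sm_sm_measure[OF h] R(1)
      by (auto simp: ca_def)
  qed
  define \<kappa> where "\<kappa> = restr M (\<lambda>A. \<phi> (restrict_sm M q A))"
  have \<kappa>: "is_sm \<Omega> M \<kappa>" unfolding \<kappa>_def by (rule blf_restrict_sm[OF \<phi> q(1)])
  have \<kappa>_le: "\<bar>\<kappa> A\<bar> \<le> C * q A" if A: "A \<in> M" for A
  proof -
    have "\<bar>\<phi> (restrict_sm M q A)\<bar> \<le> C * tvnorm \<Omega> M (restrict_sm M q A)" by (rule C(2)[OF restrict_sm_in_ca[OF q(1) A]])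
    also have "\<dots> \<le> C * tv M q A" by (rule mult_left_mono[OF tvnorm_restrict_sm_le[OF sm A] C(1)])
    finally show ?thesis using A by (simp add: \<kappa>_def restr_def tv_nonneg_sm[OF sm q(2)])
  qed
  have "abs_cont M \<kappa> q" unfolding abs_cont_iff[OF \<kappa> sm q(2)] using \<kappa>_le by fastforce
  then obtain g where g: "integrable ?N g" "\<kappa> = density_sm ?N g"
    using sm_density[OF \<kappa> sm q(2)] by blast
  \<comment> \<open>The estimate of \<kappa> by C q passes to its total variation, which is the
    integral of |g|.\<close>
  have "AE x in ?N. \<bar>g x\<bar> \<le> C"
  proof (rule N.AE_abs_le[OF g(1)])
    fix A assume "A \<in> sets ?N"
    then have A: "A \<in> M" by simp
    have "tv M \<kappa> A \<le> C * q A"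
    proof (rule tv_le)
      fix D assume D: "finite D" "D \<subseteq> M" "disjoint D" "\<Union>D \<subseteq> A"
      have "(\<Sum>B\<in>D. \<bar>\<kappa> B\<bar>) \<le> (\<Sum>B\<in>D. C * q B)" using D(2) by (intro sum_mono \<kappa>_le) auto
      also have "\<dots> = C * q (\<Union>D)" by (simp add: sm_Union[OF sm D(1-3)] sum_distrib_left)
      also have "\<dots> \<le> C * q A" using D A C(1) by (intro mult_left_mono sm_mono[OF sm q(2)]) auto
      finally show "(\<Sum>B\<in>D. \<bar>\<kappa> B\<bar>) \<le> C * q A" .
    qed
    then show "(\<integral>x. \<bar>g x\<bar> * indicator A x \<partial>?N) \<le> C * measure ?N A"
      using tv_density_sm[OF g(1), of A] A by (simp add: g(2)[symmetric] measure_sm_measure[OF sm q(2)] density_sm_def)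
  qed
  \<comment> \<open>Truncation alters g only on a null set and makes the bound C hold at every
    point, as gluing uncountably many such functions requires.\<close>
  moreover define f where "f x = max (- C) (min C (g x))" for x
  ultimately have fg: "AE x in ?N. f x = g x" by (auto simp: f_def elim!: eventually_mono)
  have fb: "\<bar>f x\<bar> \<le> C" for x using C(1) by (auto simp: f_def)
  have [measurable]: "g \<in> borel_measurable ?N" using g by simp
  have f [measurable]: "f \<in> borel_measurable ?N" unfolding f_def by measurable
  have fint: "integrable ?N (\<lambda>x. f x * h x)" if "integrable ?N h" for h
    using that fb by (intro integrable_bounded_mult[OF f]) auto
  show thesis
  proof (rule that[OF f fb])
    fix h :: "'a \<Rightarrow> real" assume "integrable ?N h"
    then show "\<phi> (density_sm ?N h) = (\<integral>x. f x * h x \<partial>?N)"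
    proof (induct h rule: integrable_induct)
      case (base A c)
      then have A: "A \<in> M" by simp
      \<comment> \<open>The summand with factor 0 brings a scalar multiple into the two-term form of
        linearity in \<open>blf\<close>.\<close>
      have "density_sm ?N (\<lambda>x. indicator A x *\<^sub>R c) = (\<lambda>B. c * restrict_sm M q A B + 0 * restrict_sm M q A B)"
      proof
        fix B
        show "density_sm ?N (\<lambda>x. indicator A x *\<^sub>R c) B = c * restrict_sm M q A B + 0 * restrict_sm M q A B"
        proof (cases "B \<in> M")
          case True
          have "(\<integral>x. indicator A x *\<^sub>R c * indicator B x \<partial>?N) = (\<integral>x. c * indicator (B \<inter> A) x \<partial>?N)"
            by (intro Bochner_Integration.integral_cong) (auto simp: indicator_def)
          also have "\<dots> = c * measure ?N (B \<inter> A)" using True A sets_into_space[OF True] by (simp add: Int_absorb2 Int_assoc inf.coboundedI1)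
          also have "\<dots> = c * q (B \<inter> A)" using True A by (simp add: measure_sm_measure[OF sm q(2)] Int)
          finally show ?thesis using True by (simp add: density_sm_def restrict_sm_def restr_def)
        qed (simp add: density_sm_def restrict_sm_def restr_def)
      qed
      then have "\<phi> (density_sm ?N (\<lambda>x. indicator A x *\<^sub>R c)) = c * \<kappa> A"
        using blf_lincomb[OF \<phi> restrict_sm_in_ca[OF q(1) A] restrict_sm_in_ca[OF q(1) A], of c 0] A
        by (simp add: \<kappa>_def restr_def)
      also have "\<dots> = (\<integral>x. c * (g x * indicator A x) \<partial>?N)" using A by (simp add: g(2) density_sm_def)
      also have "\<dots> = (\<integral>x. f x * (indicator A x *\<^sub>R c) \<partial>?N)"
      proof (rule integral_cong_AE)
        have [measurable]: "A \<in> sets ?N" using A by simp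
        show "(\<lambda>x. c * (g x * indicator A x)) \<in> borel_measurable ?N"
          "(\<lambda>x. f x * (indicator A x *\<^sub>R c)) \<in> borel_measurable ?N" by measurable
        show "AE x in ?N. c * (g x * indicator A x) = f x * (indicator A x *\<^sub>R c)"
          using fg by eventually_elim simp
      qed
      finally show ?case .
    next
      case (add h h')
      have "\<phi> (density_sm ?N (\<lambda>x. 1 * h x + 1 * h' x)) = 1 * \<phi> (density_sm ?N h) + 1 * \<phi> (density_sm ?N h')"
        unfolding density_sm_lincomb[OF add(1,3)] using add by (intro blf_lincomb[OF \<phi>] ca) auto
      then show ?case using add fint[OF add(1)] fint[OF add(3)] by (simp add: distrib_left)
    next
      case (lim h s)
      note int = lim(5,1)
      have hm [measurable]: "h \<in> borel_measurable ?N" "\<And>i. s i \<in> borel_measurable ?N" using int by auto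
      have "(\<lambda>i. \<integral>x. f x * s i x \<partial>?N) \<longlonglongrightarrow> (\<integral>x. f x * h x \<partial>?N)"
      \<comment> \<open>The factor 2 is the one in the induction rule, whose approximants satisfy
        \<open>\<bar>s i x\<bar> \<le> 2 * \<bar>h x\<bar>\<close>.\<close>
      proof (rule integral_dominated_convergence[where w="\<lambda>x. C * (2 * \<bar>h x\<bar>)"])
        show "AE x in ?N. norm (f x * s i x) \<le> C * (2 * \<bar>h x\<bar>)" for i
          using fb lim(4) C(1) by (intro AE_I2) (auto simp: abs_mult intro!: mult_mono)
        show "AE x in ?N. (\<lambda>i. f x * s i x) \<longlonglongrightarrow> f x * h x"
          using lim(3) by (intro AE_I2 tendsto_mult_left) auto
      qed (use int in auto)
      moreover have "(\<lambda>i. \<phi> (density_sm ?N (s i))) \<longlonglongrightarrow> \<phi> (density_sm ?N h)"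
      proof -
        \<comment> \<open>Convergence in L1 is convergence of the measures in total variation, along
          which \<phi> is continuous. The majorant is 2|h| for the approximant plus |h| for the
          limit.\<close>
        have "(\<lambda>i. \<integral>x. \<bar>s i x - h x\<bar> \<partial>?N) \<longlonglongrightarrow> (\<integral>x. 0 \<partial>?N)"
        proof (rule integral_dominated_convergence[where w="\<lambda>x. 3 * \<bar>h x\<bar>"])
          show "AE x in ?N. norm \<bar>s i x - h x\<bar> \<le> 3 * \<bar>h x\<bar>" for i
          proof (rule AE_I2)
            fix x assume "x \<in> space ?N"
            then have "\<bar>s i x\<bar> \<le> 2 * \<bar>h x\<bar>" using lim(4) by simp
            then show "norm \<bar>s i x - h x\<bar> \<le> 3 * \<bar>h x\<bar>" by simp
          qed
          show "AE x in ?N. (\<lambda>i. \<bar>s i x - h x\<bar>) \<longlonglongrightarrow> 0"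
          proof (rule AE_I2)
            fix x assume "x \<in> space ?N"
            then have "(\<lambda>i. s i x - h x) \<longlonglongrightarrow> 0" using lim(3) by (simp add: LIM_zero_iff)
            then show "(\<lambda>i. \<bar>s i x - h x\<bar>) \<longlonglongrightarrow> 0" by (rule tendsto_rabs_zero)
          qed
        qed (use int in auto)
        then have lim0: "(\<lambda>i. C * (\<integral>x. \<bar>s i x - h x\<bar> \<partial>?N)) \<longlonglongrightarrow> 0"
          using tendsto_mult_left[of _ 0 sequentially C] by simp
        have "norm (\<phi> (density_sm ?N (s i)) - \<phi> (density_sm ?N h)) \<le> C * (\<integral>x. \<bar>s i x - h x\<bar> \<partial>?N)" for i
        proof -
          have d: "integrable ?N (\<lambda>x. 1 * s i x + (-1) * h x)" using int by simp
          have "\<phi> (density_sm ?N (\<lambda>x. 1 * s i x + (-1) * h x)) = 1 * \<phi> (density_sm ?N (s i)) + (-1) * \<phi> (density_sm ?N h)"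
            unfolding density_sm_lincomb[OF int(2,1)] using int by (intro blf_lincomb[OF \<phi>] ca) auto
          then show ?thesis
            using C(2)[OF ca[OF d]] tvnorm_density_sm_sm_measure[OF d] by simp
        qed
        then have "(\<lambda>i. \<phi> (density_sm ?N (s i)) - \<phi> (density_sm ?N h)) \<longlonglongrightarrow> 0"
          by (intro Lim_null_comparison[OF always_eventually lim0]) blast
        then show ?thesis by (simp add: LIM_zero_iff)
      qed
      ultimately show ?case using lim(2) by (simp add: LIMSEQ_unique)
    qed
  qed
qed

end

text \<open>The properties of the Hahn-extension from which every bounded functional becomes an
  integral. \<open>glue\<close> allows uncountable unions of pieces, one in each support;
  \<open>carrier\<close> confines each member to countably many supports; \<open>dominated\<close>
  lets \<open>q i\<close> control every member inside \<open>S i\<close>. The q i are required to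
  lie in the space of measures, not in \<R>.\<close>

locale localized_family = convex_prob_family +
  fixes I :: "'i set" and q :: "'i \<Rightarrow> 'a sm" and S :: "'i \<Rightarrow> 'a set"
  assumes q_nonneg: "i \<in> I \<Longrightarrow> A \<in> M \<Longrightarrow> 0 \<le> q i A"
    and q_ca: "i \<in> I \<Longrightarrow> q i \<in> ca \<Omega> M \<R>"
    and S_sets: "i \<in> I \<Longrightarrow> S i \<in> M"
    and S_disj: "disjoint_family_on S I"
    and carrier: "R \<in> \<R> \<Longrightarrow> \<exists>K\<subseteq>I. countable K \<and> R (\<Omega> - (\<Union>i\<in>K. S i)) = 0"
    and dominated: "R \<in> \<R> \<Longrightarrow> i \<in> I \<Longrightarrow> A \<in> M \<Longrightarrow> A \<subseteq> S i \<Longrightarrow> q i A = 0 \<Longrightarrow> R A = 0"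
    and glue: "(\<And>i. i \<in> I \<Longrightarrow> E i \<in> M \<and> E i \<subseteq> S i) \<Longrightarrow> (\<Union>i\<in>I. E i) \<in> M"
begin

text \<open>A preimage under F is the union of the pieces that the f i cut out of their own
  supports, which \<open>glue\<close> admits for an index set of any size; the value 0 elsewhere
  adds the complement of all supports or nothing.\<close>

lemma glue_measurable:
  fixes f :: "'i \<Rightarrow> 'a \<Rightarrow> real"
  assumes f: "\<And>i. i \<in> I \<Longrightarrow> f i \<in> borel_measurable (meas_space \<Omega> M)"
  shows "\<exists>F\<in>borel_measurable (meas_space \<Omega> M). (\<forall>i\<in>I. \<forall>x\<in>S i. F x = f i x) \<and>
    (\<forall>x. (\<forall>i\<in>I. x \<notin> S i) \<longrightarrow> F x = 0)"
proof -
  \<comment> \<open>Disjointness of the supports makes the index unique.\<close>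
  define F where "F x = (if \<exists>i\<in>I. x \<in> S i then f (THE i. i \<in> I \<and> x \<in> S i) x else 0)" for x
  have F: "F x = f i x" if "i \<in> I" "x \<in> S i" for i x
  proof -
    have "(THE j. j \<in> I \<and> x \<in> S j) = i"
      using that S_disj by (intro the_equality) (auto simp: disjoint_family_on_def)
    then show ?thesis using that by (auto simp: F_def)
  qed
  have F0: "F x = 0" if "\<forall>i\<in>I. x \<notin> S i" for x using that by (auto simp: F_def)
  have "F \<in> borel_measurable (meas_space \<Omega> M)"
  proof (rule borel_measurableI)
    fix B :: "real set" assume "open B"
    then have B: "B \<in> sets borel" by simp
    let ?E = "\<lambda>i. f i -` B \<inter> S i"
    have SO: "S i \<subseteq> \<Omega>" if "i \<in> I" for i using S_sets[OF that] sets_into_space by blast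
    have E: "?E i \<in> M" if i: "i \<in> I" for i
    proof -
      have "f i -` B \<inter> \<Omega> \<in> M" using measurable_sets[OF f[OF i] B] by (simp add: sets_meas_space)
      then have "(f i -` B \<inter> \<Omega>) \<inter> S i \<in> M" using S_sets[OF i] by blast
      also have "(f i -` B \<inter> \<Omega>) \<inter> S i = ?E i" using SO[OF i] by blast
      finally show ?thesis .
    qed
    have "(\<Union>i\<in>I. ?E i) \<in> M" by (rule glue) (use E in blast)
    moreover have "(\<Union>i\<in>I. S i) \<in> M" by (rule glue) (use S_sets in blast)
    moreover have "F -` B \<inter> \<Omega> = (\<Union>i\<in>I. ?E i) \<union> (if 0 \<in> B then \<Omega> - (\<Union>i\<in>I. S i) else {})"
    proof (rule set_eqI)
      fix x
      show "x \<in> F -` B \<inter> \<Omega> \<longleftrightarrow> x \<in> (\<Union>i\<in>I. ?E i) \<union> (if 0 \<in> B then \<Omega> - (\<Union>i\<in>I. S i) else {})"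
      proof (cases "\<exists>i\<in>I. x \<in> S i")
        case True
        then obtain i where i: "i \<in> I" "x \<in> S i" by blast
        have "x \<in> \<Omega>" using SO i by blast
        then have "x \<in> F -` B \<inter> \<Omega> \<longleftrightarrow> f i x \<in> B" using F[OF i] by simp
        also have "\<dots> \<longleftrightarrow> x \<in> (\<Union>i\<in>I. ?E i)"
        proof
          assume "x \<in> (\<Union>i\<in>I. ?E i)"
          then obtain j where "j \<in> I" "x \<in> S j" "f j x \<in> B" by blast
          then show "f i x \<in> B" using F[of j x] F[OF i] by simp
        qed (use i in blast)
        finally show ?thesis using i by auto
      next
        case False
        then show ?thesis using F0[of x] by auto
      qed
    qed
    ultimately show "F -` B \<inter> space (meas_space \<Omega> M) \<in> sets (meas_space \<Omega> M)"
      by (auto simp: sets_meas_space)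
  qed
  then show ?thesis using F F0 by (intro bexI[of _ F]) auto
qed

lemma blf_eq_sm_integral:
  assumes \<phi>: "blf \<Omega> M \<R> \<phi>"
  shows "\<exists>f\<in>Linf \<Omega> M \<R>. \<forall>\<nu>\<in>ca \<Omega> M \<R>. \<phi> \<nu> = sm_integral \<Omega> M f \<nu>"
proof -
  obtain C where C: "0 \<le> C" "\<And>\<mu>. \<mu> \<in> ca \<Omega> M \<R> \<Longrightarrow> \<bar>\<phi> \<mu>\<bar> \<le> C * tvnorm \<Omega> M \<mu>"
    using blf_bound[OF \<phi>] by blast
  define rep where "rep i f \<longleftrightarrow> f \<in> borel_measurable (meas_space \<Omega> M) \<and> (\<forall>x. \<bar>f x\<bar> \<le> C) \<and>
      (\<forall>h. integrable (sm_measure \<Omega> M (q i)) h \<longrightarrow> \<phi> (density_sm (sm_measure \<Omega> M (q i)) h) = (\<integral>x. f x * h x \<partial>sm_measure \<Omega> M (q i)))"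
    for i and f :: "'a \<Rightarrow> real"
  have "\<exists>f. rep i f" if i: "i \<in> I" for i
  proof -
    have nn: "\<forall>A\<in>M. 0 \<le> q i A" using q_nonneg[OF i] by blast
    show ?thesis
      by (rule blf_density[OF \<phi> q_ca[OF i] nn C]) (auto simp: borel_measurable_sm_measure rep_def)
  qed
  then obtain f where "\<forall>i\<in>I. rep i (f i)"
    using bchoice[of I rep] by blast
  then have f: "\<And>i. i \<in> I \<Longrightarrow> f i \<in> borel_measurable (meas_space \<Omega> M)"
    and fC: "\<And>i x. i \<in> I \<Longrightarrow> \<bar>f i x\<bar> \<le> C"
    and fint: "\<And>i h. i \<in> I \<Longrightarrow> integrable (sm_measure \<Omega> M (q i)) h \<Longrightarrow>
      \<phi> (density_sm (sm_measure \<Omega> M (q i)) h) = (\<integral>x. f i x * h x \<partial>sm_measure \<Omega> M (q i))"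
    by (simp_all add: rep_def)
  obtain F where F: "F \<in> borel_measurable (meas_space \<Omega> M)" "\<And>i x. i \<in> I \<Longrightarrow> x \<in> S i \<Longrightarrow> F x = f i x"
    and F0: "\<And>x. (\<forall>i\<in>I. x \<notin> S i) \<Longrightarrow> F x = 0"
    using glue_measurable[of f] f by auto
  \<comment> \<open>The bound is pointwise because all f i share it pointwise; almost sure bounds
    would leave one null set for each i.\<close>
  have FC: "\<bar>F x\<bar> \<le> C" for x
    using F(2) fC F0 C(1) by (cases "\<exists>i\<in>I. x \<in> S i") auto
  have "qs \<Omega> M \<R> (\<lambda>\<omega>. \<bar>F \<omega>\<bar> \<le> C)"
    using FC by (subst qs_abs_le_iff[OF F(1)]) simp
  then have Linf: "F \<in> Linf \<Omega> M \<R>"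
    unfolding Linf_def using F(1) by blast
  define \<delta> where "\<delta> \<mu> = \<phi> \<mu> - sm_integral \<Omega> M F \<mu>" for \<mu>
  have \<delta>: "blf \<Omega> M \<R> \<delta>"
    unfolding blf_def
  proof (intro conjI ballI allI)
    fix \<mu> \<nu> a b assume "\<mu> \<in> ca \<Omega> M \<R>" "\<nu> \<in> ca \<Omega> M \<R>"
    then show "\<delta> (\<lambda>A. a * \<mu> A + b * \<nu> A) = a * \<delta> \<mu> + b * \<delta> \<nu>"
      by (simp add: \<delta>_def blf_lincomb[OF \<phi>] blf_lincomb[OF blf_sm_integral[OF Linf]] algebra_simps)
  next
    obtain D where D: "\<And>\<mu>. \<mu> \<in> ca \<Omega> M \<R> \<Longrightarrow> \<bar>sm_integral \<Omega> M F \<mu>\<bar> \<le> D * tvnorm \<Omega> M \<mu>"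
      using blf_bound[OF blf_sm_integral[OF Linf]] by blast
    have "\<bar>\<delta> \<mu>\<bar> \<le> (C + D) * tvnorm \<Omega> M \<mu>" if "\<mu> \<in> ca \<Omega> M \<R>" for \<mu>
      using C(2)[OF that] D[OF that] by (simp add: \<delta>_def distrib_right)
    then show "\<exists>C. \<forall>\<mu>\<in>ca \<Omega> M \<R>. \<bar>\<delta> \<mu>\<bar> \<le> C * tvnorm \<Omega> M \<mu>" by blast
  qed
  have "\<delta> \<nu> = 0" if \<nu>: "\<nu> \<in> ca \<Omega> M \<R>" for \<nu>
  proof -
    have sm: "is_sm \<Omega> M \<nu>" using \<nu> by (auto simp: ca_def)
    obtain R where R: "R \<in> \<R>" "abs_cont M \<nu> R" using \<nu> by (auto simp: ca_def)
    obtain K where K: "K \<subseteq> I" "countable K" "R (\<Omega> - (\<Union>i\<in>K. S i)) = 0"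
      using carrier[OF R(1)] by blast
    have null: "\<nu> B = 0" if "A \<in> M" "R A = 0" "B \<in> M" "B \<subseteq> A" for A B
      using R(2) that by (auto simp: abs_cont_def tv_eq_0_iff[OF sm])
    define \<kappa> where "\<kappa> = restr M (\<lambda>A. \<delta> (restrict_sm M \<nu> A))"
    have \<kappa>: "is_sm \<Omega> M \<kappa>" unfolding \<kappa>_def by (rule blf_restrict_sm[OF \<delta> \<nu>])
    have "\<kappa> (S i) = 0" if "i \<in> K" for i
    proof -
      have i: "i \<in> I" using that K by blast
      have Si: "S i \<in> M" by (rule S_sets[OF i])
      let ?N = "sm_measure \<Omega> M (q i)"
      have qi: "is_sm \<Omega> M (q i)" "\<forall>A\<in>M. 0 \<le> q i A"
        using q_ca[OF i] q_nonneg[OF i] by (auto simp: ca_def)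
      \<comment> \<open>\<open>dominated\<close> compares R with q i only inside \<open>S i\<close>,
        so a null set of q i is first intersected with \<open>S i\<close>.\<close>
      have "abs_cont M (restrict_sm M \<nu> (S i)) (q i)"
        unfolding abs_cont_iff[OF is_sm_restrict_sm[OF sm Si] qi]
      proof (intro ballI impI)
        fix B assume B: "B \<in> M" "q i B = 0"
        have BS: "B \<inter> S i \<in> M" using B Si by blast
        have "q i (B \<inter> S i) \<le> q i B" using B BS by (intro sm_mono[OF qi]) auto
        then have "q i (B \<inter> S i) = 0" using B qi(2) BS by force
        then have "R (B \<inter> S i) = 0" using BS by (intro dominated[OF R(1) i]) auto
        then show "restrict_sm M \<nu> (S i) B = 0"
          using null[OF BS _ BS] B by (simp add: restrict_sm_def restr_def)
      qed
      then obtain h where h: "integrable ?N h" "restrict_sm M \<nu> (S i) = density_sm ?N h"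
        using sm_density[OF is_sm_restrict_sm[OF sm Si] qi] by blast
      \<comment> \<open>Cutting the density down to \<open>S i\<close> changes nothing in the
        measure and permits replacing F by f i, with which it agrees only there.\<close>
      let ?h = "\<lambda>x. h x * indicator (S i) x"
      have h': "integrable ?N ?h" using h Si by (intro integrable_real_mult_indicator) auto
      have "density_sm ?N ?h B = restrict_sm M \<nu> (S i) B" for B
      proof (cases "B \<in> M")
        case True
        have "density_sm ?N ?h B = (\<integral>x. h x * indicator (B \<inter> S i) x \<partial>?N)"
          using True by (simp add: density_sm_def indicator_inter_arith mult_ac)
        also have "\<dots> = density_sm ?N h (B \<inter> S i)" using Int[OF True Si] by (simp add: density_sm_def)
        also have "\<dots> = restrict_sm M \<nu> (S i) (B \<inter> S i)" by (simp add: h(2))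
        also have "\<dots> = restrict_sm M \<nu> (S i) B" using True Int[OF True Si] by (simp add: restrict_sm_def restr_def Int_assoc)
        finally show ?thesis .
      qed (simp add: density_sm_def restrict_sm_def restr_def)
      then have eq: "restrict_sm M \<nu> (S i) = density_sm ?N ?h" by auto
      have FN: "F \<in> borel_measurable ?N" using F(1) by (simp add: borel_measurable_sm_measure)
      have "sm_integral \<Omega> M F (density_sm ?N ?h) = (\<integral>x. F x * ?h x \<partial>?N)"
        using sm_integral_density_sm[OF FN h' integrable_bounded_mult[OF FN h', of C]] FC by simp
      also have "\<dots> = (\<integral>x. f i x * ?h x \<partial>?N)"
        using F(2)[OF i] by (intro Bochner_Integration.integral_cong) (auto simp: indicator_def)
      also have "\<dots> = \<phi> (density_sm ?N ?h)" using fint[OF i h'] by simp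
      finally show ?thesis using Si by (simp add: \<kappa>_def restr_def \<delta>_def eq)
    qed
    \<comment> \<open>Here countability of K is essential: \<kappa> is countably additive and
      vanishes on each support.\<close>
    moreover have "((\<lambda>i. \<kappa> (S i)) has_sum \<kappa> (\<Union>i\<in>K. S i)) K"
      using K S_sets disjoint_family_on_mono[OF K(1) S_disj] by (intro sm_has_sum[OF \<kappa>]) auto
    ultimately have "((\<lambda>i. 0) has_sum \<kappa> (\<Union>i\<in>K. S i)) K"
      by (subst has_sum_cong[of K _ "\<lambda>i. \<kappa> (S i)"]) auto
    from has_sum_unique[OF this has_sum_0] have \<kappa>K: "\<kappa> (\<Union>i\<in>K. S i) = 0" by simp
    have U: "(\<Union>i\<in>K. S i) \<in> M" using K S_sets by (intro countable_UN') auto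
    then have N: "\<Omega> - (\<Union>i\<in>K. S i) \<in> M" by blast
    \<comment> \<open>Off the supports in K the measure R vanishes, hence so does \<nu>; linearity
      sends the zero measure to 0.\<close>
    have "restrict_sm M \<nu> (\<Omega> - (\<Union>i\<in>K. S i)) = (\<lambda>A. 0 * \<nu> A + 0 * \<nu> A)"
      using null[OF N K(3)] N by (auto simp: restrict_sm_def restr_def fun_eq_iff)
    then have "\<kappa> (\<Omega> - (\<Union>i\<in>K. S i)) = 0"
      using blf_lincomb[OF \<delta> \<nu> \<nu>, of 0 0] N by (simp add: \<kappa>_def restr_def)
    moreover have "\<kappa> (\<Omega> - (\<Union>i\<in>K. S i)) = \<kappa> \<Omega> - \<kappa> (\<Union>i\<in>K. S i)"
      using U sets_into_space[OF U] by (intro sm_Diff[OF \<kappa>]) auto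
    ultimately have "\<kappa> \<Omega> = 0" using \<kappa>K by simp
    then show ?thesis by (simp add: \<kappa>_def restr_def restrict_sm_space[OF sm])
  qed
  then show ?thesis using Linf by (auto simp: \<delta>_def)
qed

end

section \<open>The Hahn-extension\<close>

locale hahn_localized = convex_prob_family \<Omega> F \<P> for \<Omega> :: "'a set" and F \<P> +
  fixes \<Q> :: "'a sm set" and S :: "'a sm \<Rightarrow> 'a set"
  assumes loc: "pre_hahn \<Omega> F \<P> \<Q> S"
    and disj: "\<And>q r. q \<in> \<Q> \<Longrightarrow> r \<in> \<Q> \<Longrightarrow> q \<noteq> r \<Longrightarrow> S q \<inter> S r = {}"
begin

abbreviation H :: "'a set set" where "H \<equiv> hahn_ext \<Omega> F \<Q> S"
abbreviation extn :: "'a sm \<Rightarrow> 'a sm" where "extn \<equiv> ext \<Omega> F \<Q> S"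
abbreviation \<P>\<Q> :: "'a sm set" where "\<P>\<Q> \<equiv> extn ` \<P>"

lemma loc_sm: "q \<in> \<Q> \<Longrightarrow> is_sm \<Omega> F q" "q \<in> \<Q> \<Longrightarrow> \<forall>A\<in>F. 0 \<le> q A" "q \<in> \<Q> \<Longrightarrow> q \<Omega> = 1"
  using loc unfolding pre_hahn_def is_prob_def by auto

lemma S_sets: "q \<in> \<Q> \<Longrightarrow> S q \<in> F"
  using loc unfolding pre_hahn_def by auto

lemma loc_supp: "q \<in> \<Q> \<Longrightarrow> r \<in> \<Q> \<Longrightarrow> q (S r) = (if q = r then 1 else 0)"
  using loc unfolding pre_hahn_def by auto

lemma S_disj: "disjoint_family_on S \<Q>"
  unfolding disjoint_family_on_def using disj by blast

section \<open>Traces of the Hahn-extension on the supports\<close>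

lemma sigma_algebra_H: "sigma_algebra \<Omega> H"
  unfolding hahn_ext_def
proof (rule sigma_algebra_sigma_sets)
  have "(\<Union>q\<in>\<Q>. E q) \<subseteq> \<Omega>" if "\<forall>q\<in>\<Q>. E q \<in> F \<and> E q \<subseteq> S q" for E
    using that sets_into_space by blast
  then show "F \<union> {(\<Union>q\<in>\<Q>. E q) | E. \<forall>q\<in>\<Q>. E q \<in> F \<and> E q \<subseteq> S q} \<subseteq> Pow \<Omega>"
    using space_closed by auto
qed

lemma F_subset_H: "F \<subseteq> H"
  unfolding hahn_ext_def by (auto intro: sigma_sets.Basic)

lemma H_glue: "(\<Union>q\<in>\<Q>. E q) \<in> H" if "\<And>q. q \<in> \<Q> \<Longrightarrow> E q \<in> F \<and> E q \<subseteq> S q"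
  unfolding hahn_ext_def using that by (intro sigma_sets.Basic UnI2) blast

text \<open>Having a trace in F is preserved by complements and countable unions. A generator
  \<Union>E_Q meets \<open>S q\<close> exactly in its own piece, because the supports are disjoint.
  Thus the extension adds no new sets inside a single support.\<close>

lemma H_trace:
  assumes "A \<in> H" and q: "q \<in> \<Q>"
  shows "A \<inter> S q \<in> F"
  using assms(1) unfolding hahn_ext_def
proof (induct rule: sigma_sets.induct)
  case (Basic A)
  then consider "A \<in> F" | E where "A = (\<Union>r\<in>\<Q>. E r)" "\<forall>r\<in>\<Q>. E r \<in> F \<and> E r \<subseteq> S r" by blast
  then show ?case
  proof cases
    case 1
    then show ?thesis using S_sets[OF q] by blast
  next
    case 2
    have "A \<inter> S q = E q"
    proof
      show "A \<inter> S q \<subseteq> E q"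
      proof
        fix x assume x: "x \<in> A \<inter> S q"
        then obtain r where r: "r \<in> \<Q>" "x \<in> E r" using 2 by blast
        then have "r = q" using disj[OF r(1) q] 2 x by blast
        then show "x \<in> E q" using r by simp
      qed
    qed (use 2 q in blast)
    then show ?thesis using 2 q by simp
  qed
next
  case (Compl A)
  have "(\<Omega> - A) \<inter> S q = S q - A \<inter> S q" using sets_into_space[OF S_sets[OF q]] by blast
  then show ?case using Diff[OF S_sets[OF q] Compl(2)] by simp
next
  case (Union A)
  have "(\<Union>i. A i \<inter> S q) \<in> F" using Union(2) by blast
  then show ?case by simp
qed simp

lemma H_trace_UN:
  assumes "A \<in> H" "K \<subseteq> \<Q>" "countable K"
  shows "A \<inter> (\<Union>q\<in>K. S q) \<in> F"
proof -
  have "(\<Union>q\<in>K. A \<inter> S q) \<in> F" using assms H_trace by (intro countable_UN') auto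
  then show ?thesis by simp
qed

text \<open>All sets of F that avoid the union are required to be null, not just its complement: a
  signed measure may vanish on a set without vanishing on its subsets. The condition survives
  enlarging K, which gives any two measures a common carrier.\<close>

definition carried :: "'a sm set \<Rightarrow> 'a sm \<Rightarrow> bool" where
  "carried K \<mu> \<longleftrightarrow> K \<subseteq> \<Q> \<and> countable K \<and> (\<forall>A\<in>F. A \<inter> (\<Union>q\<in>K. S q) = {} \<longrightarrow> \<mu> A = 0)"

lemma carriedD:
  assumes "carried K \<mu>"
  shows "K \<subseteq> \<Q>" "countable K" "\<And>A. A \<in> F \<Longrightarrow> A \<inter> (\<Union>q\<in>K. S q) = {} \<Longrightarrow> \<mu> A = 0"
  using assms unfolding carried_def by blast+

lemma carried_Un:
  assumes "carried K \<mu>" "carried L \<nu>"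
  shows "carried (K \<union> L) \<mu>" "carried (K \<union> L) \<nu>"
  using carriedD[OF assms(1)] carriedD[OF assms(2)] unfolding carried_def by (simp_all add: Int_Un_distrib)

text \<open>\<open>S q\<close> already has the full mass 1 of q.\<close>

lemma loc_null:
  assumes q: "q \<in> \<Q>" and A: "A \<in> F" "A \<inter> S q = {}"
  shows "q A = 0"
proof -
  have "q (A \<union> S q) = q A + q (S q)" using A S_sets[OF q] by (intro sm_Un[OF loc_sm(1)[OF q]]) auto
  moreover have "q (A \<union> S q) \<le> q \<Omega>"
    using A(1) S_sets[OF q] sets_into_space by (intro sm_mono[OF loc_sm(1,2)[OF q]]) auto
  ultimately show ?thesis using loc_supp[OF q q] loc_sm[OF q] A(1) by force
qed

lemma family_in_ca: "P \<in> \<P> \<Longrightarrow> P \<in> ca \<Omega> F \<P>"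
  using family_sm[of P] abs_cont_iff[of P P] by (auto simp: ca_def)

text \<open>Only null sets matter from here on, so the weights of the countable mixture dominating P
  can be forgotten and its sequence of components kept.\<close>

lemma family_sconv:
  assumes P: "P \<in> \<P>"
  shows "\<exists>q::nat \<Rightarrow> 'a sm. (\<forall>n. q n \<in> \<Q>) \<and> (\<forall>A\<in>F. (\<forall>n. q n A = 0) \<longrightarrow> P A = 0)"
proof -
  obtain R where R: "R \<in> sconv \<Q>" "abs_cont F P R"
    using loc P unfolding pre_hahn_def lll_def by blast
  then obtain c :: "nat \<Rightarrow> real" and q where q: "\<forall>n. q n \<in> \<Q>" "\<forall>A. (\<lambda>n. c n * q n A) sums R A"
    by (auto simp: sconv_def)
  have "P A = 0" if A: "A \<in> F" and qA: "\<And>n. q n A = 0" for A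
  proof -
    have "(\<lambda>n. 0) sums R A" using q(2)[rule_format, of A] by (simp add: qA)
    then have "R A = 0" using sums_unique2[OF sums_zero] by metis
    then have "tv F P A = 0" using R(2) A by (simp add: abs_cont_def)
    then show ?thesis using A by (auto simp: tv_eq_0_iff[OF family_sm(1)[OF P]])
  qed
  then show ?thesis using q(1) by (intro exI[of _ q]) auto
qed

lemma ca_carried:
  assumes \<mu>: "\<mu> \<in> ca \<Omega> F \<P>"
  obtains K where "carried K \<mu>"
proof -
  obtain P where P: "P \<in> \<P>" "abs_cont F \<mu> P" using \<mu> by (auto simp: ca_def)
  have sm: "is_sm \<Omega> F \<mu>" using \<mu> by (auto simp: ca_def)
  obtain q :: "nat \<Rightarrow> 'a sm" where q: "\<And>n. q n \<in> \<Q>"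
    and null: "\<And>A. A \<in> F \<Longrightarrow> (\<And>n. q n A = 0) \<Longrightarrow> P A = 0"
    using family_sconv[OF P(1)] by auto
  have "\<mu> A = 0" if A: "A \<in> F" "A \<inter> (\<Union>r\<in>range q. S r) = {}" for A
  proof -
    have "q n A = 0" for n using A by (intro loc_null[OF q]) auto
    then have "P A = 0" by (rule null[OF A(1)])
    then show ?thesis using P(2) A(1) by (auto simp: abs_cont_def tv_eq_0_iff[OF sm])
  qed
  then have "carried (range q) \<mu>" using q unfolding carried_def by auto
  then show ?thesis by (rule that)
qed

lemma carried_eq:
  assumes "is_sm \<Omega> F \<mu>" "carried K \<mu>" "A \<in> F"
  shows "\<mu> (A \<inter> (\<Union>q\<in>K. S q)) = \<mu> A"
proof -
  note K = carriedD[OF assms(2)]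
  have U: "A \<inter> (\<Union>q\<in>K. S q) \<in> F" using assms(3) F_subset_H K by (intro H_trace_UN) auto
  have "\<mu> (A - A \<inter> (\<Union>q\<in>K. S q)) = 0" using U assms(3) by (intro K(3)) auto
  then show ?thesis using sm_Diff[OF assms(1,3) U] by simp
qed

text \<open>Only countably many supports carry \<open>\<mu>\<close>, so the sum defining its extension is the measure of
  a single set of \<open>F\<close>.\<close>

lemma ext_eq:
  assumes sm: "is_sm \<Omega> F \<mu>" and car: "carried K \<mu>" and A: "A \<in> H"
  shows "extn \<mu> A = \<mu> (A \<inter> (\<Union>q\<in>K. S q))"
proof -
  note K = carriedD[OF car]
  have AS: "A \<inter> S q \<in> F" if "q \<in> \<Q>" for q using H_trace[OF A that] .
  have "((\<lambda>q. \<mu> (A \<inter> S q)) has_sum \<mu> (\<Union>q\<in>K. A \<inter> S q)) K"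
  proof (rule sm_has_sum[OF sm K(2)])
    show "disjoint_family_on (\<lambda>q. A \<inter> S q) K"
      unfolding disjoint_family_on_def using disj K(1) by blast
  qed (use AS K(1) in blast)
  \<comment> \<open>K is a chosen carrier, while the definition sums over the supports charged by
    \<mu>. An index in only one of the two sets contributes 0, either by disjointness from the
    carrier or by vanishing variation.\<close>
  also have "?this \<longleftrightarrow> ((\<lambda>q. \<mu> (A \<inter> S q)) has_sum \<mu> (\<Union>q\<in>K. A \<inter> S q)) {q\<in>\<Q>. 0 < tv F \<mu> (S q)}"
  proof (rule has_sum_cong_neutral)
    fix q assume q: "q \<in> {q\<in>\<Q>. 0 < tv F \<mu> (S q)} - K"
    then have "S q \<inter> S r = {}" if "r \<in> K" for r using disj[of q r] K(1) that by blast
    then show "\<mu> (A \<inter> S q) = 0" using q by (intro K(3) AS) auto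
  next
    fix q assume q: "q \<in> K - {q\<in>\<Q>. 0 < tv F \<mu> (S q)}"
    then have "q \<in> \<Q>" "tv F \<mu> (S q) = 0" using K(1) tv_nonneg[OF sm, of "S q"] by force+
    then show "\<mu> (A \<inter> S q) = 0" using AS by (auto simp: tv_eq_0_iff[OF sm])
  qed simp
  finally show ?thesis using A by (simp add: ext_def infsumI)
qed

lemma is_sm_ext:
  assumes sm: "is_sm \<Omega> F \<mu>" and car: "carried K \<mu>"
  shows "is_sm \<Omega> H (extn \<mu>)"
proof (rule is_smI)
  fix A :: "nat \<Rightarrow> 'a set" assume A: "range A \<subseteq> H" "disjoint_family A"
  interpret H: sigma_algebra \<Omega> H by (rule sigma_algebra_H)
  let ?U = "\<Union>q\<in>K. S q"
  have Ai: "A i \<in> H" for i using A by auto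
  have "(\<lambda>i. \<mu> (A i \<inter> ?U)) sums \<mu> (\<Union>i. A i \<inter> ?U)"
    using A(2) H_trace_UN[OF Ai carriedD(1,2)[OF car]]
    by (intro sm_sums[OF sm]) (auto simp: disjoint_family_on_def)
  moreover have "(\<Union>i. A i) \<in> H" using Ai by blast
  ultimately show "(\<lambda>i. extn \<mu> (A i)) sums extn \<mu> (\<Union>i. A i)"
    by (simp add: ext_eq[OF sm car] Ai)
qed (simp add: ext_def)

lemma ca_sm: "\<mu> \<in> ca \<Omega> F \<P> \<Longrightarrow> is_sm \<Omega> F \<mu>"
  by (simp add: ca_def)

lemma is_sm_ext_ca: "\<mu> \<in> ca \<Omega> F \<P> \<Longrightarrow> is_sm \<Omega> H (extn \<mu>)"
  by (rule ca_carried, assumption) (rule is_sm_ext[OF ca_sm])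

lemma ext_on_F:
  assumes "\<mu> \<in> ca \<Omega> F \<P>" "A \<in> F"
  shows "extn \<mu> A = \<mu> A"
proof -
  obtain K where "carried K \<mu>" using assms(1) by (rule ca_carried)
  then show ?thesis using assms F_subset_H by (simp add: ext_eq[OF ca_sm] carried_eq[OF ca_sm] subsetD)
qed

lemma restr_ext: "\<mu> \<in> ca \<Omega> F \<P> \<Longrightarrow> restr F (extn \<mu>) = \<mu>"
  by (auto simp: restr_def ext_on_F fun_eq_iff sm_outside[OF ca_sm])

lemma ext_nonneg:
  assumes "\<mu> \<in> ca \<Omega> F \<P>" "\<forall>A\<in>F. 0 \<le> \<mu> A"
  shows "0 \<le> extn \<mu> A"
proof (cases "A \<in> H")
  case True
  obtain K where K: "carried K \<mu>" using assms(1) by (rule ca_carried)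
  then show ?thesis
    using assms(2) H_trace_UN[OF True carriedD(1,2)[OF K]] by (simp add: ext_eq[OF ca_sm[OF assms(1)] K True])
qed (simp add: ext_def)

text \<open>The index set in \<open>ext\<close> depends on the measure, which hides linearity. Over
  the common carrier \<open>K \<union> L\<close> all three extensions are evaluated at one and the
  same set of F.\<close>

lemma ext_lincomb:
  assumes \<mu>: "\<mu> \<in> ca \<Omega> F \<P>" and \<nu>: "\<nu> \<in> ca \<Omega> F \<P>"
  shows "extn (\<lambda>A. a * \<mu> A + b * \<nu> A) = (\<lambda>A. a * extn \<mu> A + b * extn \<nu> A)"
proof
  fix A
  obtain K where K: "carried K \<mu>" using \<mu> by (rule ca_carried)
  obtain L where L: "carried L \<nu>" using \<nu> by (rule ca_carried)
  note KL = carried_Un[OF K L]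
  have KL': "carried (K \<union> L) (\<lambda>A. a * \<mu> A + b * \<nu> A)"
    using carriedD[OF KL(1)] carriedD(3)[OF KL(2)] unfolding carried_def by simp
  show "extn (\<lambda>A. a * \<mu> A + b * \<nu> A) A = a * extn \<mu> A + b * extn \<nu> A"
  proof (cases "A \<in> H")
    case True
    then show ?thesis
      by (simp add: ext_eq[OF ca_sm[OF \<mu>] KL(1)] ext_eq[OF ca_sm[OF \<nu>] KL(2)]
          ext_eq[OF sm_lincomb[OF ca_sm[OF \<mu>] ca_sm[OF \<nu>]] KL'])
  qed (simp add: ext_def)
qed

section \<open>Extension and restriction as inverse isometries\<close>

lemma ext_abs_cont:
  assumes \<mu>: "\<mu> \<in> ca \<Omega> F \<P>" and P: "P \<in> \<P>" and ac: "abs_cont F \<mu> P"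
  shows "abs_cont H (extn \<mu>) (extn P)"
proof -
  interpret H: sigma_algebra \<Omega> H by (rule sigma_algebra_H)
  note Pca = family_in_ca[OF P]
  obtain K where K: "carried K \<mu>" using \<mu> by (rule ca_carried)
  obtain L where L: "carried L P" using Pca by (rule ca_carried)
  note KL = carried_Un[OF K L]
  have nn: "\<forall>A\<in>H. 0 \<le> extn P A" using ext_nonneg[OF Pca family_sm(2)[OF P]] by blast
  show ?thesis
    unfolding H.abs_cont_iff[OF is_sm_ext_ca[OF \<mu>] is_sm_ext_ca[OF Pca] nn]
  proof (intro ballI impI)
    fix A assume A: "A \<in> H" "extn P A = 0"
    have "A \<inter> (\<Union>q\<in>K \<union> L. S q) \<in> F" by (rule H_trace_UN[OF A(1) carriedD(1,2)[OF KL(1)]])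
    then show "extn \<mu> A = 0"
      using A ac unfolding ext_eq[OF ca_sm[OF \<mu>] KL(1) A(1)] ext_eq[OF ca_sm[OF Pca] KL(2) A(1)]
        abs_cont_iff[OF ca_sm[OF \<mu>] family_sm[OF P]] by blast
  qed
qed

lemma ext_in_ca:
  assumes \<mu>: "\<mu> \<in> ca \<Omega> F \<P>"
  shows "extn \<mu> \<in> ca \<Omega> H \<P>\<Q>"
proof -
  obtain P where P: "P \<in> \<P>" "abs_cont F \<mu> P" using \<mu> by (auto simp: ca_def)
  show ?thesis
    unfolding ca_def using ext_abs_cont[OF \<mu> P] P(1) is_sm_ext_ca[OF \<mu>] by blast
qed

text \<open>\<nu> is dominated by some extended P, and a carrier of P has a complement that is null
  for that extension, hence for \<nu>. So \<nu> is determined by its values on sets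
  \<open>A \<inter> U\<close> with U the union of the carrying supports, and these belong to
  F.\<close>

lemma
  assumes \<nu>: "\<nu> \<in> ca \<Omega> H \<P>\<Q>"
  shows restr_in_ca: "restr F \<nu> \<in> ca \<Omega> F \<P>" and ext_restr: "extn (restr F \<nu>) = \<nu>"
proof -
  interpret H: sigma_algebra \<Omega> H by (rule sigma_algebra_H)
  have sm: "is_sm \<Omega> H \<nu>" using \<nu> by (auto simp: ca_def)
  obtain P where P: "P \<in> \<P>" "abs_cont H \<nu> (extn P)" using \<nu> by (auto simp: ca_def)
  note Pca = family_in_ca[OF P(1)]
  have nn: "\<forall>A\<in>H. 0 \<le> extn P A" using ext_nonneg[OF Pca family_sm(2)[OF P(1)]] by blast
  have null: "\<nu> A = 0" if "A \<in> H" "extn P A = 0" for A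
    using P(2) that unfolding H.abs_cont_iff[OF sm is_sm_ext_ca[OF Pca] nn] by blast
  have rsm: "is_sm \<Omega> F (restr F \<nu>)"
  proof (rule is_smI)
    fix A :: "nat \<Rightarrow> 'a set" assume A: "range A \<subseteq> F" "disjoint_family A"
    have "(\<lambda>i. \<nu> (A i)) sums \<nu> (\<Union>i. A i)" using A F_subset_H by (intro sm_sums[OF sm]) auto
    moreover have "A i \<in> F" "(\<Union>i. A i) \<in> F" for i using A by auto
    ultimately show "(\<lambda>i. restr F \<nu> (A i)) sums restr F \<nu> (\<Union>i. A i)" by (simp add: restr_def)
  qed (simp add: restr_def)
  have rnull: "restr F \<nu> A = 0" if A: "A \<in> F" "P A = 0" for A
    using null[of A] A F_subset_H ext_on_F[OF Pca A(1)] by (auto simp: restr_def)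
  then have "abs_cont F (restr F \<nu>) P"
    using abs_cont_iff[OF rsm family_sm[OF P(1)]] by blast
  then show "restr F \<nu> \<in> ca \<Omega> F \<P>" using P(1) rsm by (auto simp: ca_def)
  obtain K where K: "carried K P" using Pca by (rule ca_carried)
  have rK: "carried K (restr F \<nu>)"
    using carriedD[OF K] rnull unfolding carried_def by blast
  show "extn (restr F \<nu>) = \<nu>"
  proof
    fix A
    let ?U = "A \<inter> (\<Union>q\<in>K. S q)"
    show "extn (restr F \<nu>) A = \<nu> A"
    proof (cases "A \<in> H")
      case A: True
      have U: "?U \<in> F" by (rule H_trace_UN[OF A carriedD(1,2)[OF K]])
      then have UH: "?U \<in> H" using F_subset_H by blast
      have AU: "A - ?U \<in> H" using A UH by blast
      have "(A - ?U) \<inter> (\<Union>q\<in>K. S q) = {}" by blast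
      then have "extn P (A - ?U) = 0"
        using ext_eq[OF ca_sm[OF Pca] K AU] sm_empty[OF ca_sm[OF Pca]] by simp
      then have "\<nu> (A - ?U) = 0" by (rule null[OF AU])
      then have "\<nu> ?U = \<nu> A" using H.sm_Diff[OF sm A UH] by simp
      then show ?thesis using U unfolding ext_eq[OF rsm rK A] by (simp add: restr_def)
    qed (simp add: ext_def sm_outside[OF sm])
  qed
qed

text \<open>Intersecting a disjoint family in H with the union of a carrier gives a disjoint family
  in F with the same values; conversely every family in F is one in H.\<close>

lemma tvnorm_ext:
  assumes \<mu>: "\<mu> \<in> ca \<Omega> F \<P>"
  shows "tvnorm \<Omega> H (extn \<mu>) = tvnorm \<Omega> F \<mu>"
  unfolding tvnorm_def
proof (rule antisym)
  interpret H: sigma_algebra \<Omega> H by (rule sigma_algebra_H)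
  show "tv H (extn \<mu>) \<Omega> \<le> tv F \<mu> \<Omega>"
  proof (rule H.tv_le)
    fix D assume D: "finite D" "D \<subseteq> H" "disjoint D" "\<Union>D \<subseteq> \<Omega>"
    obtain K where K: "carried K \<mu>" using \<mu> by (rule ca_carried)
    let ?U = "\<Union>q\<in>K. S q"
    have "(\<Sum>B\<in>D. \<bar>extn \<mu> B\<bar>) = (\<Sum>B\<in>D. \<bar>\<mu> (B \<inter> ?U)\<bar>)"
      using D(2) by (intro sum.cong) (auto simp: ext_eq[OF ca_sm[OF \<mu>] K])
    also have "\<dots> = (\<Sum>B\<in>(\<lambda>B. B \<inter> ?U) ` D. \<bar>\<mu> B\<bar>)"
      using sum_abs_Int_image[of D \<mu> ?U, OF D(1) sm_empty[OF ca_sm[OF \<mu>]] D(3)] by simp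
    also have "\<dots> \<le> tv F \<mu> \<Omega>"
    proof (rule sum_le_tv[OF ca_sm[OF \<mu>]])
      show "(\<lambda>B. B \<inter> ?U) ` D \<subseteq> F" using D(2) H_trace_UN[OF _ carriedD(1,2)[OF K]] by blast
      show "disjoint ((\<lambda>B. B \<inter> ?U) ` D)" using D(3) unfolding disjoint_def by blast
    qed (use D in auto)
    finally show "(\<Sum>B\<in>D. \<bar>extn \<mu> B\<bar>) \<le> tv F \<mu> \<Omega>" .
  qed
  show "tv F \<mu> \<Omega> \<le> tv H (extn \<mu>) \<Omega>"
  proof (rule tv_le)
    fix D assume D: "finite D" "D \<subseteq> F" "disjoint D" "\<Union>D \<subseteq> \<Omega>"
    have "(\<Sum>B\<in>D. \<bar>\<mu> B\<bar>) = (\<Sum>B\<in>D. \<bar>extn \<mu> B\<bar>)"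
      using D(2) by (intro sum.cong) (auto simp: ext_on_F[OF \<mu>])
    also have "\<dots> \<le> tv H (extn \<mu>) \<Omega>"
      using D F_subset_H by (intro H.sum_le_tv[OF is_sm_ext_ca[OF \<mu>]]) auto
    finally show "(\<Sum>B\<in>D. \<bar>\<mu> B\<bar>) \<le> tv H (extn \<mu>) \<Omega>" .
  qed
qed

lemma bij_betw_restr: "bij_betw (restr F) (ca \<Omega> H \<P>\<Q>) (ca \<Omega> F \<P>)"
  by (rule bij_betw_byWitness[where f'=extn])
    (auto simp: ext_restr restr_ext intro: restr_in_ca ext_in_ca)

text \<open>The half \<open>lll F \<Q> \<P>\<close> of the localization is what puts q among the
  measures to which extension and functionals apply.\<close>

lemma loc_in_ca:
  assumes q: "q \<in> \<Q>"
  shows "q \<in> ca \<Omega> F \<P>"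
  using loc q loc_sm(1)[OF q] unfolding pre_hahn_def lll_def ca_def by blast

lemma localized_family_ext: "localized_family \<Omega> H \<P>\<Q> \<Q> extn S"
proof -
  interpret H: sigma_algebra \<Omega> H by (rule sigma_algebra_H)
  show ?thesis
  proof unfold_locales
    fix R assume "R \<in> \<P>\<Q>"
    then obtain P where P: "P \<in> \<P>" "R = extn P" by blast
    note Pca = family_in_ca[OF P(1)]
    have "P \<Omega> = 1" using probs[OF P(1)] by (simp add: is_prob_def)
    then show "is_prob \<Omega> H R"
      using ext_nonneg[OF Pca family_sm(2)[OF P(1)]] ext_on_F[OF Pca top] is_sm_ext_ca[OF Pca]
      by (simp add: is_prob_def P(2))
    obtain K where K: "carried K P" using Pca by (rule ca_carried)
    have "(\<Union>q\<in>K. S q) \<in> F"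
      using carriedD[OF K] S_sets by (intro countable_UN') auto
    then have "\<Omega> - (\<Union>q\<in>K. S q) \<in> F" by blast
    then have "R (\<Omega> - (\<Union>q\<in>K. S q)) = 0"
      using carriedD(3)[OF K, of "\<Omega> - (\<Union>q\<in>K. S q)"] by (auto simp: P(2) ext_on_F[OF Pca])
    then show "\<exists>K\<subseteq>\<Q>. countable K \<and> R (\<Omega> - (\<Union>q\<in>K. S q)) = 0"
      using carriedD(1,2)[OF K] by blast
    fix q A assume q: "q \<in> \<Q>" and A: "A \<in> H" "A \<subseteq> S q" "extn q A = 0"
    have "A \<inter> S q = A" using A by blast
    \<comment> \<open>Inside one support H and F coincide, so the comparison of null sets can be
      made with the original measures.\<close>
    then have AF: "A \<in> F" using H_trace[OF A(1) q] by simp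
    obtain r :: "nat \<Rightarrow> 'a sm" where r: "\<And>n. r n \<in> \<Q>"
      and null: "\<And>A. A \<in> F \<Longrightarrow> (\<And>n. r n A = 0) \<Longrightarrow> P A = 0"
      using family_sconv[OF P(1)] by auto
    \<comment> \<open>A component other than q lives on a support disjoint from \<open>S q\<close>,
      so being q-null decides the matter for every component.\<close>
    have "r n A = 0" for n
    proof (cases "r n = q")
      case True
      then show ?thesis using A(3) ext_on_F[OF loc_in_ca[OF q] AF] by simp
    next
      case False
      then have "S (r n) \<inter> S q = {}" by (rule disj[OF r q])
      then show ?thesis using A(2) by (intro loc_null[OF r AF]) blast
    qed
    then have "P A = 0" by (rule null[OF AF])
    then show "R A = 0" by (simp add: P(2) ext_on_F[OF Pca AF])
  next
    show "convex_family \<P>\<Q>"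
      unfolding convex_family_def
    proof (intro ballI allI impI)
      fix R R' and t :: real assume R: "R \<in> \<P>\<Q>" "R' \<in> \<P>\<Q>" and t: "0 \<le> t \<and> t \<le> 1"
      obtain P P' where P: "P \<in> \<P>" "R = extn P" and P': "P' \<in> \<P>" "R' = extn P'" using R by blast
      have "(\<lambda>A. t * P A + (1 - t) * P' A) \<in> \<P>"
        using convex P(1) P'(1) t unfolding convex_family_def by blast
      moreover have "(\<lambda>A. t * R A + (1 - t) * R' A) = extn (\<lambda>A. t * P A + (1 - t) * P' A)"
        using ext_lincomb[OF family_in_ca[OF P(1)] family_in_ca[OF P'(1)], of t "1 - t"] by (simp add: P(2) P'(2))
      ultimately show "(\<lambda>A. t * R A + (1 - t) * R' A) \<in> \<P>\<Q>" by blast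
    qed
  next
    fix q assume q: "q \<in> \<Q>"
    show "0 \<le> extn q A" for A by (rule ext_nonneg[OF loc_in_ca[OF q] loc_sm(2)[OF q]])
    show "extn q \<in> ca \<Omega> H \<P>\<Q>" by (rule ext_in_ca[OF loc_in_ca[OF q]])
    show "S q \<in> H" using S_sets[OF q] F_subset_H by blast
  next
    show "disjoint_family_on S \<Q>" by (rule S_disj)
  next
    fix E assume E: "\<And>q. q \<in> \<Q> \<Longrightarrow> E q \<in> H \<and> E q \<subseteq> S q"
    \<comment> \<open>Pieces taken from H inside a support are already pieces from F. Hence H is
      closed under its own gluing, and the extension need not be iterated.\<close>
    have "E q \<in> F \<and> E q \<subseteq> S q" if "q \<in> \<Q>" for q
      using E[OF that] H_trace[of "E q" q] that by (simp add: Int_absorb2)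
    then show "(\<Union>q\<in>\<Q>. E q) \<in> H" by (rule H_glue)
  qed
qed

section \<open>Transport of functionals along the extension\<close>

sublocale H: localized_family \<Omega> H \<P>\<Q> \<Q> extn S
  by (rule localized_family_ext)

text \<open>\<open>extn\<close> is a linear isometry of one space of measures onto the other, so
  linearity and boundedness are the same condition on both sides.\<close>

lemma blf_ext_iff:
  assumes "\<And>\<mu>. \<mu> \<in> ca \<Omega> F \<P> \<Longrightarrow> \<phi> \<mu> = \<psi> (extn \<mu>)"
  shows "blf \<Omega> F \<P> \<phi> \<longleftrightarrow> blf \<Omega> H \<P>\<Q> \<psi>"
proof -
  have im: "ca \<Omega> H \<P>\<Q> = extn ` ca \<Omega> F \<P>"
    using ext_in_ca ext_restr restr_in_ca by (auto intro: image_eqI[OF sym])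
  show ?thesis
    unfolding blf_def im by (simp add: assms ca_lincomb ext_lincomb[symmetric] tvnorm_ext)
qed

lemma opnorm_ext:
  assumes "\<And>\<mu>. \<mu> \<in> ca \<Omega> F \<P> \<Longrightarrow> \<phi> \<mu> = \<psi> (extn \<mu>)"
  shows "opnorm \<Omega> F \<P> \<phi> = opnorm \<Omega> H \<P>\<Q> \<psi>"
proof -
  have im: "ca \<Omega> H \<P>\<Q> = extn ` ca \<Omega> F \<P>"
    using ext_in_ca ext_restr restr_in_ca by (auto intro: image_eqI[OF sym])
  show ?thesis
    unfolding opnorm_def im by (simp add: assms tvnorm_ext cong: conj_cong)
qed

end

theorem theorem4p6:
  fixes \<Omega> :: "'a set" and F :: "'a set set" and \<P> \<Q> :: "'a sm set"
    and S :: "'a sm \<Rightarrow> 'a set"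
  assumes sa: "sigma_algebra \<Omega> F"
    and probs: "\<forall>P\<in>\<P>. is_prob \<Omega> F P"
    and cvx: "convex_family \<P>"
    and loc: "pre_hahn \<Omega> F \<P> \<Q> S"
    and disj: "\<forall>Q\<in>\<Q>. \<forall>R\<in>\<Q>. Q \<noteq> R \<longrightarrow> S Q \<inter> S R = {}"
  defines "H \<equiv> hahn_ext \<Omega> F \<Q> S"
    and "\<P>\<Q> \<equiv> ext \<Omega> F \<Q> S ` \<P>"
  shows "bij_betw (restr F) (ca \<Omega> H \<P>\<Q>) (ca \<Omega> F \<P>)
       \<and> (\<forall>\<nu>\<in>ca \<Omega> H \<P>\<Q>. tvnorm \<Omega> F (restr F \<nu>) = tvnorm \<Omega> H \<nu>)
       \<and> (\<exists>T :: ('a \<Rightarrow> real) \<Rightarrow> ('a sm \<Rightarrow> real).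
            (\<forall>f\<in>Linf \<Omega> H \<P>\<Q>. blf \<Omega> F \<P> (T f))
          \<and> (\<forall>f\<in>Linf \<Omega> H \<P>\<Q>. \<forall>g\<in>Linf \<Omega> H \<P>\<Q>. \<forall>a b. \<forall>\<mu>\<in>ca \<Omega> F \<P>.
                T (\<lambda>\<omega>. a * f \<omega> + b * g \<omega>) \<mu> = a * T f \<mu> + b * T g \<mu>)
          \<and> (\<forall>f\<in>Linf \<Omega> H \<P>\<Q>. \<forall>g\<in>Linf \<Omega> H \<P>\<Q>.
                (\<forall>\<mu>\<in>ca \<Omega> F \<P>. T f \<mu> = T g \<mu>) \<longleftrightarrow> qs \<Omega> H \<P>\<Q> (\<lambda>\<omega>. f \<omega> = g \<omega>))
          \<and> (\<forall>\<phi>. blf \<Omega> F \<P> \<phi> \<longrightarrow> (\<exists>f\<in>Linf \<Omega> H \<P>\<Q>. \<forall>\<mu>\<in>ca \<Omega> F \<P>. \<phi> \<mu> = T f \<mu>))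
          \<and> (\<forall>f\<in>Linf \<Omega> H \<P>\<Q>. opnorm \<Omega> F \<P> (T f) = linf_norm \<Omega> H \<P>\<Q> f))"
proof -
  interpret sigma_algebra \<Omega> F by (rule sa)
  interpret L: hahn_localized \<Omega> F \<P> \<Q> S
    by unfold_locales (use probs cvx loc disj in auto)
  \<comment> \<open>The pairing is available on H, where the functions are measurable; the extension
    pulls it back to measures on F.\<close>
  define T where "T f \<mu> = sm_integral \<Omega> H f (ext \<Omega> F \<Q> S \<mu>)" for f \<mu>
  show ?thesis
  proof (intro conjI exI[of _ T] ballI allI impI)
    show "bij_betw (restr F) (ca \<Omega> H \<P>\<Q>) (ca \<Omega> F \<P>)"
      unfolding H_def \<P>\<Q>_def by (rule L.bij_betw_restr)
  next
    fix \<nu> assume "\<nu> \<in> ca \<Omega> H \<P>\<Q>"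
    then show "tvnorm \<Omega> F (restr F \<nu>) = tvnorm \<Omega> H \<nu>"
      unfolding H_def \<P>\<Q>_def using L.tvnorm_ext[OF L.restr_in_ca, of \<nu>] by (simp add: L.ext_restr)
  next
    fix f assume "f \<in> Linf \<Omega> H \<P>\<Q>"
    then show "blf \<Omega> F \<P> (T f)"
      unfolding H_def \<P>\<Q>_def
      by (subst L.blf_ext_iff[of _ "sm_integral \<Omega> H f"]) (simp_all add: T_def H_def L.H.blf_sm_integral)
  next
    fix f g a b \<mu> assume "f \<in> Linf \<Omega> H \<P>\<Q>" "g \<in> Linf \<Omega> H \<P>\<Q>" "\<mu> \<in> ca \<Omega> F \<P>"
    then show "T (\<lambda>\<omega>. a * f \<omega> + b * g \<omega>) \<mu> = a * T f \<mu> + b * T g \<mu>"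
      unfolding T_def H_def \<P>\<Q>_def by (intro L.H.sm_integral_lincomb_fun L.ext_in_ca)
  next
    fix f g assume fg: "f \<in> Linf \<Omega> H \<P>\<Q>" "g \<in> Linf \<Omega> H \<P>\<Q>"
    have "(\<forall>\<mu>\<in>ca \<Omega> F \<P>. T f \<mu> = T g \<mu>) \<longleftrightarrow> (\<forall>\<nu>\<in>ca \<Omega> H \<P>\<Q>. sm_integral \<Omega> H f \<nu> = sm_integral \<Omega> H g \<nu>)"
      unfolding T_def H_def \<P>\<Q>_def using L.ext_in_ca L.restr_in_ca L.ext_restr by metis
    also have "\<dots> \<longleftrightarrow> qs \<Omega> H \<P>\<Q> (\<lambda>\<omega>. f \<omega> = g \<omega>)"
      using fg unfolding H_def \<P>\<Q>_def by (rule L.H.sm_integral_eq_iff)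
    finally show "(\<forall>\<mu>\<in>ca \<Omega> F \<P>. T f \<mu> = T g \<mu>) \<longleftrightarrow> qs \<Omega> H \<P>\<Q> (\<lambda>\<omega>. f \<omega> = g \<omega>)" .
  next
    fix \<phi> assume "blf \<Omega> F \<P> \<phi>"
    \<comment> \<open>Composition with the restriction, the inverse of the extension, moves \<phi>
      to H, where gluing is possible.\<close>
    then have "blf \<Omega> H \<P>\<Q> (\<phi> \<circ> restr F)"
      unfolding H_def \<P>\<Q>_def by (subst L.blf_ext_iff[symmetric, of \<phi>]) (simp_all add: L.restr_ext)
    then obtain f where f: "f \<in> Linf \<Omega> H \<P>\<Q>" "\<forall>\<nu>\<in>ca \<Omega> H \<P>\<Q>. (\<phi> \<circ> restr F) \<nu> = sm_integral \<Omega> H f \<nu>"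
      unfolding H_def \<P>\<Q>_def using L.H.blf_eq_sm_integral by blast
    have "\<phi> \<mu> = T f \<mu>" if "\<mu> \<in> ca \<Omega> F \<P>" for \<mu>
      using f(2)[unfolded H_def \<P>\<Q>_def, rule_format, OF L.ext_in_ca[OF that]]
      by (simp add: L.restr_ext[OF that] T_def H_def)
    then show "\<exists>f\<in>Linf \<Omega> H \<P>\<Q>. \<forall>\<mu>\<in>ca \<Omega> F \<P>. \<phi> \<mu> = T f \<mu>" using f(1) by blast
  next
    fix f assume "f \<in> Linf \<Omega> H \<P>\<Q>"
    then show "opnorm \<Omega> F \<P> (T f) = linf_norm \<Omega> H \<P>\<Q> f"
      unfolding H_def \<P>\<Q>_def
      by (subst L.opnorm_ext[of _ "sm_integral \<Omega> H f"]) (simp_all add: T_def H_def L.H.opnorm_sm_integral)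
  qed
qed

end
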